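(* The provability problem for $\mathsf{MSL}(\omega)$ reduces to the provability problem for existential-free $\mathsf{MSL}(\omega)$: there is a computable function mapping every instance $(\Sigma,\Pi,D,G)$ of $\mathsf{MSL}(\omega)$ provability to an instance $(\Sigma',\Pi',D',G')$ of $\mathsf{MSL}(\omega)$ provability in which neither $D'$ nor $G'$ contains an existential quantifier, such that $D\vdash G$ if and only if $D'\vdash G'$.
   Context: **Types.** Constructor types: $\gamma ::= \iota \mid \gamma \to \gamma$; $o$ is the type of propositions. **$\mathsf{MSL}(\omega)$ syntax.** $\Sigma$ is a finite set of function symbols $c:\gamma$ of arbitrary constructor types, $\Pi$ a finite set of predicate symbols, all of type $\iota\to o$. Terms are simply typed applicative terms built from variables of constructor types and symbols of $\Sigma$ (no $\lambda$-abstraction). Atomic formulas have the form $A = P\,s$ with $P\in\Pi$ and $s$ a term of type $\iota$. Goal formulas: $G ::= A \mid G \wedge G \mid \exists x{:}\gamma.\,G \mid \mathsf{true}$. Definite formulas are finite conjunctions (possibly $\mathsf{true}$) of definite clauses of the forms $\forall y{:}\iota.\,G \Rightarrow P\,y$ and $\forall \overline{y{:}\gamma}.\,G \Rightarrow P\,(c\,\overline{y})$, where $P\in\Pi$, $c\in\Sigma$, the variables $\overline y$ are pairwise distinct, $G$ is a goal formula, and everything is well typed. Formulas are identified up to renaming of bound variables and associativity and commutativity of $\wedge$ with unit $\mathsf{true}$; a definite formula is also viewed as its set of clauses. All instances consist of closed formulas. **Proof system.** $D \vdash G$ is defined inductively: $D \vdash \mathsf{true}$; if $D\vdash G$ and $D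 \vdash H$ then $D \vdash G\wedge H$; if $D \vdash G[t/x]$ for some closed term $t$ of the type of $x$ then $D \vdash \exists x.\,G$; if $(\forall\overline y.\,G\Rightarrow A)\in D$ and $D \vdash G[\overline s/\overline y]$ for closed terms $\overline s$ of the types of $\overline y$, then $D \vdash A[\overline s/\overline y]$. **Problem.** The provability problem is: given finite signatures $\Sigma,\Pi$, a definite formula $D$ and a goal formula $G$ of the fragment, decide whether $D\vdash G$. *)

theory Defs
  imports Main "HOL-Library.Nat_Bijection"
begin

section \<open>Syntax of MSL(omega)\<close>

datatype ty = Iota | Arrow ty ty

text \<open>
  Variables are de Bruijn indices, so that formulas differing only in the names of bound variables
  are equal.  Function and predicate symbols are named by natural numbers.  Predicate symbols need
  no type, since they all have type \<open>\<iota> \<rightarrow> o\<close>.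
\<close>

datatype tm = Var nat | Sym nat | App tm tm

datatype goal =
    Atom nat tm
  | Conj goal goal
  | Exists ty goal
  | Tru

text \<open>
  \<open>Clause [\<gamma>\<^sub>0, \<dots>, \<gamma>\<^sub>n] G P s\<close> is the formula \<open>\<forall>y\<^sub>0:\<gamma>\<^sub>0. \<dots> \<forall>y\<^sub>n:\<gamma>\<^sub>n. G \<Rightarrow> P s\<close>, in which \<open>y\<^sub>i\<close> is the
  index \<open>i\<close> (outside of the existential quantifiers of \<open>G\<close>).  The restriction on the shape of the
  head is part of \<open>wf_clause\<close> below.
\<close>

datatype clause = Clause "ty list" goal nat tm

text \<open>
  A list of clauses stands for their conjunction; the empty list is the formula \<open>true\<close>.
\<close>

type_synonym definite = "clause list"

type_synonym signature = "(nat \<times> ty) list"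

datatype problem =
  Problem (funs: signature) (preds: "nat list") (defn: definite) (query: goal)

definition arrows :: "ty list \<Rightarrow> ty \<Rightarrow> ty" where
  "arrows \<gamma>s \<gamma> = foldr Arrow \<gamma>s \<gamma>"

definition apps :: "tm \<Rightarrow> tm list \<Rightarrow> tm" where
  "apps s ts = foldl App s ts"

section \<open>Typing and well-formedness\<close>

inductive has_type :: "signature \<Rightarrow> ty list \<Rightarrow> tm \<Rightarrow> ty \<Rightarrow> bool" for \<Sigma> \<Gamma> where
  "i < length \<Gamma> \<Longrightarrow> has_type \<Sigma> \<Gamma> (Var i) (\<Gamma> ! i)"
| "(c, \<gamma>) \<in> set \<Sigma> \<Longrightarrow> has_type \<Sigma> \<Gamma> (Sym c) \<gamma>"
| "has_type \<Sigma> \<Gamma> s (Arrow \<gamma> \<delta>) \<Longrightarrow> has_type \<Sigma> \<Gamma> t \<gamma> \<Longrightarrow> has_type \<Sigma> \<Gamma> (App s t) \<delta>"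

abbreviation closed_term :: "signature \<Rightarrow> tm \<Rightarrow> ty \<Rightarrow> bool" where
  "closed_term \<Sigma> t \<gamma> \<equiv> has_type \<Sigma> [] t \<gamma>"

fun wf_goal :: "signature \<Rightarrow> nat list \<Rightarrow> ty list \<Rightarrow> goal \<Rightarrow> bool" where
  "wf_goal \<Sigma> \<Pi> \<Gamma> (Atom P s) \<longleftrightarrow> P \<in> set \<Pi> \<and> has_type \<Sigma> \<Gamma> s Iota"
| "wf_goal \<Sigma> \<Pi> \<Gamma> (Conj G H) \<longleftrightarrow> wf_goal \<Sigma> \<Pi> \<Gamma> G \<and> wf_goal \<Sigma> \<Pi> \<Gamma> H"
| "wf_goal \<Sigma> \<Pi> \<Gamma> (Exists \<gamma> G) \<longleftrightarrow> wf_goal \<Sigma> \<Pi> (\<gamma> # \<Gamma>) G"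
| "wf_goal \<Sigma> \<Pi> \<Gamma> Tru \<longleftrightarrow> True"

text \<open>
  The two disjuncts are the heads \<open>P y\<close> with \<open>y : \<iota>\<close>, and \<open>P (c y\<^sub>0 \<dots> y\<^sub>n)\<close> with \<open>c\<close> applied to all of
  the (hence pairwise distinct) quantified variables.
\<close>

fun wf_clause :: "signature \<Rightarrow> nat list \<Rightarrow> clause \<Rightarrow> bool" where
  "wf_clause \<Sigma> \<Pi> (Clause \<gamma>s G P s) \<longleftrightarrow>
     P \<in> set \<Pi> \<and> wf_goal \<Sigma> \<Pi> \<gamma>s G \<and>
     (\<gamma>s = [Iota] \<and> s = Var 0 \<or>
      (\<exists>c. (c, arrows \<gamma>s Iota) \<in> set \<Sigma> \<and> s = apps (Sym c) (map Var [0..<length \<gamma>s])))"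

definition wf_problem :: "problem \<Rightarrow> bool" where
  "wf_problem I \<longleftrightarrow>
     distinct (map fst (funs I)) \<and> distinct (preds I) \<and>
     (\<forall>C \<in> set (defn I). wf_clause (funs I) (preds I) C) \<and>
     wf_goal (funs I) (preds I) [] (query I)"

fun ex_free :: "goal \<Rightarrow> bool" where
  "ex_free (Atom P s) \<longleftrightarrow> True"
| "ex_free (Conj G H) \<longleftrightarrow> ex_free G \<and> ex_free H"
| "ex_free (Exists \<gamma> G) \<longleftrightarrow> False"
| "ex_free Tru \<longleftrightarrow> True"

fun ex_free_clause :: "clause \<Rightarrow> bool" where
  "ex_free_clause (Clause \<gamma>s G P s) \<longleftrightarrow> ex_free G"

definition ex_free_problem :: "problem \<Rightarrow> bool" where
  "ex_free_problem I \<longleftrightarrow> (\<forall>C \<in> set (defn I). ex_free_clause C) \<and> ex_free (query I)"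

section \<open>Substitution and provability\<close>

text \<open>
  A substitution assigns terms to all indices.  Only closed terms and variables are ever
  substituted in the proof system, but \<open>lift\<close> makes \<open>subst_goal\<close> capture-avoiding in general.
\<close>

type_synonym sub = "nat \<Rightarrow> tm"

fun subst :: "sub \<Rightarrow> tm \<Rightarrow> tm" where
  "subst \<sigma> (Var i) = \<sigma> i"
| "subst \<sigma> (Sym c) = Sym c"
| "subst \<sigma> (App s t) = App (subst \<sigma> s) (subst \<sigma> t)"

definition lift :: "sub \<Rightarrow> sub" where
  "lift \<sigma> = case_nat (Var 0) (\<lambda>i. subst (\<lambda>j. Var (Suc j)) (\<sigma> i))"

fun subst_goal :: "sub \<Rightarrow> goal \<Rightarrow> goal" where
  "subst_goal \<sigma> (Atom P s) = Atom P (subst \<sigma> s)"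
| "subst_goal \<sigma> (Conj G H) = Conj (subst_goal \<sigma> G) (subst_goal \<sigma> H)"
| "subst_goal \<sigma> (Exists \<gamma> G) = Exists \<gamma> (subst_goal (lift \<sigma>) G)"
| "subst_goal \<sigma> Tru = Tru"

text \<open>Index \<open>i\<close> is replaced by the \<open>i\<close>-th term of the list; the remaining indices move down.\<close>

definition inst :: "tm list \<Rightarrow> sub" where
  "inst ts i = (if i < length ts then ts ! i else Var (i - length ts))"

inductive provable :: "signature \<Rightarrow> definite \<Rightarrow> goal \<Rightarrow> bool" for \<Sigma> D where
  "provable \<Sigma> D Tru"
| "provable \<Sigma> D G \<Longrightarrow> provable \<Sigma> D H \<Longrightarrow> provable \<Sigma> D (Conj G H)"
| "closed_term \<Sigma> t \<gamma> \<Longrightarrow> provable \<Sigma> D (subst_goal (inst [t]) G) \<Longrightarrow> provable \<Sigma> D (Exists \<gamma> G)"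
| "Clause \<gamma>s G P s \<in> set D \<Longrightarrow> list_all2 (closed_term \<Sigma>) ts \<gamma>s \<Longrightarrow>
     provable \<Sigma> D (subst_goal (inst ts) G) \<Longrightarrow>
     provable \<Sigma> D (subst_goal (inst ts) (Atom P s))"

definition provable_problem :: "problem \<Rightarrow> bool" where
  "provable_problem I \<longleftrightarrow> provable (funs I) (defn I) (query I)"

section \<open>Computable functions\<close>

text \<open>
  Partial recursive functions on the natural numbers: \<open>evals r xs y\<close> says that the program \<open>r\<close> is
  defined at the argument tuple \<open>xs\<close>, with value \<open>y\<close>.  \<open>PrimRec\<close> recurses on the first argument;
  \<open>Mu r\<close> searches for the least zero of \<open>r\<close> in its first argument.
\<close>

datatype recf =
    Zero
  | Succ
  | Proj nat
  | Comp recf "recf list"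
  | PrimRec recf recf
  | Mu recf

inductive evals :: "recf \<Rightarrow> nat list \<Rightarrow> nat \<Rightarrow> bool" where
  "evals Zero xs 0"
| "evals Succ [x] (Suc x)"
| "i < length xs \<Longrightarrow> evals (Proj i) xs (xs ! i)"
| "list_all2 (\<lambda>g y. evals g xs y) gs ys \<Longrightarrow> evals f ys z \<Longrightarrow> evals (Comp f gs) xs z"
| "evals f xs y \<Longrightarrow> evals (PrimRec f g) (0 # xs) y"
| "evals (PrimRec f g) (n # xs) y \<Longrightarrow> evals g (n # y # xs) z \<Longrightarrow>
     evals (PrimRec f g) (Suc n # xs) z"
| "(\<And>m. m < n \<Longrightarrow> \<exists>k. evals f (m # xs) (Suc k)) \<Longrightarrow> evals f (n # xs) 0 \<Longrightarrow> evals (Mu f) xs n"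

fun enc_ty :: "ty \<Rightarrow> nat" where
  "enc_ty Iota = 0"
| "enc_ty (Arrow \<gamma> \<delta>) = Suc (prod_encode (enc_ty \<gamma>, enc_ty \<delta>))"

fun enc_tm :: "tm \<Rightarrow> nat" where
  "enc_tm (Var i) = prod_encode (0, i)"
| "enc_tm (Sym c) = prod_encode (1, c)"
| "enc_tm (App s t) = prod_encode (2, prod_encode (enc_tm s, enc_tm t))"

fun enc_goal :: "goal \<Rightarrow> nat" where
  "enc_goal (Atom P s) = prod_encode (0, prod_encode (P, enc_tm s))"
| "enc_goal (Conj G H) = prod_encode (1, prod_encode (enc_goal G, enc_goal H))"
| "enc_goal (Exists \<gamma> G) = prod_encode (2, prod_encode (enc_ty \<gamma>, enc_goal G))"
| "enc_goal Tru = prod_encode (3, 0)"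

fun enc_clause :: "clause \<Rightarrow> nat" where
  "enc_clause (Clause \<gamma>s G P s) =
     list_encode [list_encode (map enc_ty \<gamma>s), enc_goal G, P, enc_tm s]"

fun enc_problem :: "problem \<Rightarrow> nat" where
  "enc_problem (Problem \<Sigma> \<Pi> D G) =
     list_encode
       [list_encode (map (\<lambda>(c, \<gamma>). prod_encode (c, enc_ty \<gamma>)) \<Sigma>),
        list_encode \<Pi>,
        list_encode (map enc_clause D),
        enc_goal G]"

definition computable :: "(problem \<Rightarrow> problem) \<Rightarrow> bool" where
  "computable f \<longleftrightarrow> (\<exists>r. \<forall>I. evals r [enc_problem I] (enc_problem (f I)))"

text \<open>The encoding of problems is faithful, and programs have at most one value.\<close>

lemma enc_ty_inject [simp]: "enc_ty \<gamma> = enc_ty \<delta> \<longleftrightarrow> \<gamma> = \<delta>"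
proof (induction \<gamma> arbitrary: \<delta>)
  case Iota
  then show ?case by (cases \<delta>) auto
next
  case (Arrow \<gamma>1 \<gamma>2)
  then show ?case by (cases \<delta>) auto
qed

lemma enc_tm_inject [simp]: "enc_tm s = enc_tm t \<longleftrightarrow> s = t"
proof (induction s arbitrary: t)
  case (Var x)
  then show ?case by (cases t) auto
next
  case (Sym x)
  then show ?case by (cases t) auto
next
  case (App s1 s2)
  then show ?case by (cases t) auto
qed

lemma enc_goal_inject [simp]: "enc_goal G = enc_goal H \<longleftrightarrow> G = H"
proof (induction G arbitrary: H)
  case (Atom P s)
  then show ?case by (cases H) auto
next
  case (Conj G1 G2)
  then show ?case by (cases H) auto
next
  case (Exists \<gamma> G)
  then show ?case by (cases H) auto
next
  case Tru
  then show ?case by (cases H) auto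
qed

lemma enc_clause_inject [simp]: "enc_clause C = enc_clause C' \<longleftrightarrow> C = C'"
  by (cases C; cases C') (auto simp: list_encode_eq inj_map_eq_map inj_def)

lemma enc_problem_inject: "enc_problem I = enc_problem J \<longleftrightarrow> I = J"
proof -
  have "inj (\<lambda>(c :: nat, \<gamma>). prod_encode (c, enc_ty \<gamma>))" "inj enc_clause"
    by (auto simp: inj_def)
  then show ?thesis
    by (cases I; cases J) (auto simp: list_encode_eq inj_map_eq_map)
qed

inductive_cases evals_ZeroE: "evals Zero xs y"
inductive_cases evals_SuccE: "evals Succ xs y"
inductive_cases evals_ProjE: "evals (Proj i) xs y"
inductive_cases evals_CompE: "evals (Comp f gs) xs y"
inductive_cases evals_PrimRec0E: "evals (PrimRec f g) (0 # xs) y"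
inductive_cases evals_PrimRecSucE: "evals (PrimRec f g) (Suc n # xs) y"
inductive_cases evals_MuE: "evals (Mu f) xs y"

lemma evals_functional: "evals r xs y \<Longrightarrow> evals r xs z \<Longrightarrow> y = z"
proof (induction arbitrary: z rule: evals.induct)
  case (1 xs)
  then show ?case by (rule evals_ZeroE) simp
next
  case (2 x)
  then show ?case by (rule evals_SuccE) simp
next
  case (3 i xs)
  from "3.prems" show ?case by (rule evals_ProjE) simp
next
  case (4 xs gs ys f z z')
  from "4.prems" obtain ys' where ys': "list_all2 (\<lambda>g y. evals g xs y) gs ys'" "evals f ys' z'"
    by (rule evals_CompE)
  have "ys = ys'"
    using "4.IH"(1) ys'(1) by (auto simp: list_all2_conv_all_nth intro!: nth_equalityI)
  then show ?case using "4.IH"(2) ys'(2) by simp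
next
  case (5 f xs y g)
  from "5.prems" have "evals f xs z" by (rule evals_PrimRec0E)
  then show ?case by (rule "5.IH")
next
  case (6 f g n xs y z z')
  from "6.prems" obtain y' where "evals (PrimRec f g) (n # xs) y'" "evals g (n # y' # xs) z'"
    by (rule evals_PrimRecSucE)
  then show ?case using "6.IH" by metis
next
  case (7 n f xs z)
  from "7.prems" have z: "evals f (z # xs) 0" "\<And>m. m < z \<Longrightarrow> \<exists>k. evals f (m # xs) (Suc k)"
    by (auto elim: evals_MuE)
  show ?case
  proof (rule linorder_cases[of n z])
    assume "n < z"
    then show ?thesis using z(2) "7.IH"(2) by (metis nat.distinct(1))
  next
    assume "z < n"
    then show ?thesis using z(1) "7.IH"(1) by (metis nat.distinct(1))
  qed
qed

end

theory Submission
  imports Defs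
begin

text \<open>
  Every occurrence of a subgoal \<open>G\<close> in a context \<open>\<Gamma>\<close> becomes a function symbol from \<open>\<Gamma>\<close> to \<open>\<iota>\<close>, and a
  fresh predicate \<open>Q\<close> holds of this symbol applied to \<open>ys\<close> iff \<open>G[ys]\<close> is provable; one clause per
  occurrence unfolds one connective.  An existential quantifier over \<open>\<gamma>\<close> becomes a search in
  continuation-passing style for a closed term \<open>t : \<gamma>\<close>, started as \<open>Q (search w)\<close> with the continuation
  \<open>w : \<gamma> \<rightarrow> \<iota>\<close>.  Either \<open>t\<close> is a symbol \<open>c\<close>, and the search goes on to \<open>Q (w c)\<close>, or it is an application
  \<open>s u\<close>, and the search first looks for \<open>u\<close>, then for \<open>s\<close>, and goes on to \<open>Q (w (s u))\<close>.  Heads of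
  clauses determine all their variables, so the fresh symbols never enter the terms of the original
  program.  A type of a closed term is a suffix of the type of a symbol, so finitely many types suffice:
  all types with a small enough code.  This choice, like the numbering of fresh symbols by codes, keeps
  the reduction easy to compute.
\<close>

section \<open>Total recursive functions on the natural numbers\<close>

definition recursive :: "nat \<Rightarrow> (nat list \<Rightarrow> nat) \<Rightarrow> bool" where
  "recursive k F \<longleftrightarrow> (\<exists>r. \<forall>xs. length xs = k \<longrightarrow> evals r xs (F xs))"

abbreviation unary :: "(nat \<Rightarrow> nat) \<Rightarrow> bool" where
  "unary f \<equiv> recursive (Suc 0) (\<lambda>xs. f (xs ! 0))"

abbreviation binary :: "(nat \<Rightarrow> nat \<Rightarrow> nat) \<Rightarrow> bool" where
  "binary f \<equiv> recursive 2 (\<lambda>xs. f (xs ! 0) (xs ! 1))"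

lemma unary_iff: "unary f \<longleftrightarrow> (\<exists>r. \<forall>x. evals r [x] (f x))"
proof -
  have "(\<forall>xs. length xs = Suc 0 \<longrightarrow> P xs) \<longleftrightarrow> (\<forall>x. P [x])" for P :: "nat list \<Rightarrow> bool"
    by (auto simp: length_Suc_conv)
  then show ?thesis unfolding recursive_def by simp
qed

lemma binary_iff: "binary f \<longleftrightarrow> (\<exists>r. \<forall>x y. evals r [x, y] (f x y))"
proof -
  have "(\<forall>xs. length xs = 2 \<longrightarrow> P xs) \<longleftrightarrow> (\<forall>x y. P [x, y])" for P :: "nat list \<Rightarrow> bool"
    by (auto simp: length_Suc_conv numeral_2_eq_2)
  then show ?thesis unfolding recursive_def by simp
qed

named_theorems recursive_intros

lemma recursive_proj [recursive_intros]: "i < k \<Longrightarrow> recursive k (\<lambda>xs. xs ! i)"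
  unfolding recursive_def by (intro exI[of _ "Proj i"]) (auto intro: evals.intros)

lemma recursive_comp1:
  assumes "unary f" "recursive k G"
  shows "recursive k (\<lambda>xs. f (G xs))"
proof -
  obtain r s where r: "\<And>x. evals r [x] (f x)" and s: "\<And>xs. length xs = k \<Longrightarrow> evals s xs (G xs)"
    using assms unfolding unary_iff by (auto simp: recursive_def)
  have "evals (Comp r [s]) xs (f (G xs))" if "length xs = k" for xs
    by (rule evals.intros(4)[where ys = "[G xs]"]) (use r s that in auto)
  then show ?thesis unfolding recursive_def by blast
qed

lemma recursive_comp2:
  assumes "binary f" "recursive k G" "recursive k H"
  shows "recursive k (\<lambda>xs. f (G xs) (H xs))"
proof -
  obtain r s t where r: "\<And>x y. evals r [x, y] (f x y)"
    and s: "\<And>xs. length xs = k \<Longrightarrow> evals s xs (G xs)"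
    and t: "\<And>xs. length xs = k \<Longrightarrow> evals t xs (H xs)"
    using assms unfolding binary_iff by (auto simp: recursive_def)
  have "evals (Comp r [s, t]) xs (f (G xs) (H xs))" if "length xs = k" for xs
    by (rule evals.intros(4)[where ys = "[G xs, H xs]"]) (use r s t that in auto)
  then show ?thesis unfolding recursive_def by blast
qed

lemma recursive_Suc [recursive_intros]: "recursive k G \<Longrightarrow> recursive k (\<lambda>xs. Suc (G xs))"
  using recursive_comp1[of Suc] unary_iff[of Suc] evals.intros(2) by blast

lemma recursive_const [recursive_intros]: "recursive k (\<lambda>xs. c)"
proof (induction c)
  case 0
  show ?case unfolding recursive_def by (auto intro: evals.intros)
next
  case (Suc c)
  then show ?case by (rule recursive_Suc)
qed

text \<open>Iteration is primitive recursion whose step looks only at the previous value, which is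
  argument \<open>Proj 1\<close> of the step. Sums, differences, case distinctions and later all
  list processing are reduced to it.\<close>

lemma binary_funpow:
  assumes "unary s"
  shows "binary (\<lambda>n x. (s ^^ n) x)"
proof -
  obtain r where r: "\<And>x. evals r [x] (s x)"
    using assms unfolding unary_iff by blast
  have "evals (PrimRec (Proj 0) (Comp r [Proj 1])) [n, x] ((s ^^ n) x)" for n x
  proof (induction n)
    case 0
    show ?case using evals.intros(3)[of 0 "[x]"] by (auto intro: evals.intros)
  next
    case (Suc n)
    have "evals (Comp r [Proj 1]) [n, (s ^^ n) x, x] (s ((s ^^ n) x))"
      by (rule evals.intros(4)[where ys = "[(s ^^ n) x]"])
        (use r evals.intros(3)[of 1 "[n, (s ^^ n) x, x]"] in auto)
    with Suc show ?case by (auto intro: evals.intros)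
  qed
  then show ?thesis using binary_iff[of "\<lambda>n x. (s ^^ n) x"] by blast
qed

lemma unary_rec_nat:
  assumes "binary g"
  shows "unary (rec_nat a g)"
proof -
  obtain r where r: "\<And>x y. evals r [x, y] (g x y)"
    using assms unfolding binary_iff by blast
  \<comment> \<open>Without parameters, the base case is evaluated at the empty tuple.\<close>
  obtain z where z: "evals z [] a"
    using recursive_const[of 0 a] unfolding recursive_def by auto
  have "evals (PrimRec z r) [n] (rec_nat a g n)" for n
    by (induction n) (use r z in \<open>auto intro: evals.intros\<close>)
  then show ?thesis unfolding unary_iff by blast
qed

lemma unary_Least:
  assumes "binary f" "\<And>x. \<exists>n. f n x = 0"
  shows "unary (\<lambda>x. LEAST n. f n x = 0)"
proof -
  obtain r where r: "\<And>x y. evals r [x, y] (f x y)"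
    using assms unfolding binary_iff by blast
  have "evals (Mu r) [x] (LEAST n. f n x = 0)" for x
  proof (rule evals.intros(7))
    show "evals r ((LEAST n. f n x = 0) # [x]) 0"
      using r[of "LEAST n. f n x = 0" x] LeastI_ex[OF assms(2), of x] by simp
  next
    fix m assume "m < (LEAST n. f n x = 0)"
    then have "f m x \<noteq> 0" by (rule not_less_Least)
    then show "\<exists>k. evals r (m # [x]) (Suc k)"
      using r[of m x] by (metis not0_implies_Suc)
  qed
  then show ?thesis using unary_iff[of "\<lambda>x. LEAST n. f n x = 0"] by blast
qed

lemma recursive_add [recursive_intros]:
  "recursive k F \<Longrightarrow> recursive k G \<Longrightarrow> recursive k (\<lambda>xs. F xs + G xs)"
proof (rule recursive_comp2[where f = "(+)"])
  have "(Suc ^^ n) x = n + x" for n x by (induction n) auto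
  then show "binary (+)"
    using binary_funpow[of Suc] by (simp add: recursive_intros)
qed

lemma recursive_diff [recursive_intros]:
  assumes "recursive k F" "recursive k G"
  shows "recursive k (\<lambda>xs. F xs - G xs)"
\<comment> \<open>The arguments are swapped because the subtrahend counts the iterations of the
  predecessor.\<close>
proof (rule recursive_comp2[where f = "\<lambda>n x. x - n", OF _ assms(2,1)])
  have pred: "unary (\<lambda>n. n - 1)"
  proof -
    have "rec_nat 0 (\<lambda>n _. n) n = n - 1" for n :: nat by (cases n) auto
    then show ?thesis
      using unary_rec_nat[of "\<lambda>n _. n" 0] by (simp add: recursive_intros)
  qed
  have "((\<lambda>n. n - 1) ^^ n) x = x - n" for n x :: nat by (induction n) auto
  then show "binary (\<lambda>n x. x - n)"
    using binary_funpow[OF pred] by simp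
qed

lemma recursive_triangle [recursive_intros]:
  "recursive k F \<Longrightarrow> recursive k (\<lambda>xs. triangle (F xs))"
proof (rule recursive_comp1[where f = triangle])
  have "rec_nat 0 (\<lambda>n y. y + Suc n) n = triangle n" for n by (induction n) auto
  then show "unary triangle"
    using unary_rec_nat[of "\<lambda>n y. y + Suc n" 0] by (simp add: recursive_intros)
qed

lemma recursive_prod_encode [recursive_intros]:
  "recursive k F \<Longrightarrow> recursive k G \<Longrightarrow> recursive k (\<lambda>xs. prod_encode (F xs, G xs))"
  unfolding prod_encode_def by (auto intro!: recursive_intros)

lemma triangle_ge: "n \<le> triangle n"
  by (induction n) auto

lemma triangle_mono: "m \<le> n \<Longrightarrow> triangle m \<le> triangle n"
  by (induction rule: dec_induct) auto

text \<open>\<open>prod_encode (a, b)\<close> is \<open>triangle (a + b) + a\<close>, hence lies at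
  or above \<open>triangle (a + b)\<close> and below \<open>triangle (Suc (a + b))\<close>. The
  truncated difference vanishes iff the code is below \<open>triangle (Suc d)\<close>, and the
  diagonal \<open>a + b\<close> is the least such \<open>d\<close>.\<close>

lemma Least_triangle: "(LEAST d. Suc (prod_encode (a, b)) - triangle (Suc d) = 0) = a + b"
proof (rule Least_equality)
  show "Suc (prod_encode (a, b)) - triangle (Suc (a + b)) = 0"
    by (simp add: prod_encode_def)
next
  fix d assume d: "Suc (prod_encode (a, b)) - triangle (Suc d) = 0"
  show "a + b \<le> d"
  proof (rule ccontr)
    assume "\<not> a + b \<le> d"
    then have "triangle (Suc d) \<le> triangle (a + b)" by (intro triangle_mono) simp
    with d show False by (simp add: prod_encode_def)
  qed
qed

text \<open>Unpairing rests on finding the diagonal. This is the only use of unbounded minimization;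
  the search stops because \<open>triangle\<close> dominates the identity.\<close>

lemma unary_sum_decode: "unary (\<lambda>z. fst (prod_decode z) + snd (prod_decode z))"
proof -
  have *: "(LEAST d. Suc z - triangle (Suc d) = 0) = fst (prod_decode z) + snd (prod_decode z)" for z
    using Least_triangle[of "fst (prod_decode z)" "snd (prod_decode z)"] by simp
  have "\<exists>d. Suc z - triangle (Suc d) = 0" for z
    using triangle_ge[of "Suc z"] by (intro exI[of _ z]) (simp del: triangle_Suc)
  then have "unary (\<lambda>z. LEAST d. Suc z - triangle (Suc d) = 0)"
    by (intro unary_Least recursive_intros) auto
  then show ?thesis by (simp only: *)
qed

lemma recursive_fst_prod_decode [recursive_intros]:
  "recursive k F \<Longrightarrow> recursive k (\<lambda>xs. fst (prod_decode (F xs)))"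
proof (rule recursive_comp1[where f = "\<lambda>z. fst (prod_decode z)"])
  have *: "fst (prod_decode z) = z - triangle (fst (prod_decode z) + snd (prod_decode z))" for z
    using prod_decode_inverse[of z] by (cases "prod_decode z") (auto simp: prod_encode_def)
  show "unary (\<lambda>z. fst (prod_decode z))"
    by (subst *) (intro recursive_intros unary_sum_decode; simp)
qed

lemma recursive_snd_prod_decode [recursive_intros]:
  "recursive k F \<Longrightarrow> recursive k (\<lambda>xs. snd (prod_decode (F xs)))"
proof (rule recursive_comp1[where f = "\<lambda>z. snd (prod_decode z)"])
  have *: "snd (prod_decode z) = (fst (prod_decode z) + snd (prod_decode z)) - fst (prod_decode z)" for z
    by simp
  show "unary (\<lambda>z. snd (prod_decode z))"
    by (subst *) (intro recursive_diff recursive_fst_prod_decode unary_sum_decode recursive_proj; simp)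
qed

text \<open>Both branches are computed and paired. Iterating \<open>s\<close>, which overwrites the
  first component by the second, keeps \<open>F xs\<close> in front if the count is zero and puts
  \<open>G xs\<close> there for any positive count.\<close>

lemma recursive_if_zero [recursive_intros]:
  assumes "recursive k C" "recursive k F" "recursive k G"
  shows "recursive k (\<lambda>xs. if C xs = 0 then F xs else G xs)"
proof -
  define s where "s z = prod_encode (snd (prod_decode z), snd (prod_decode z))" for z
  have "unary s"
    unfolding s_def by (intro recursive_intros) auto
  then have "recursive k (\<lambda>xs. fst (prod_decode ((s ^^ C xs) (prod_encode (F xs, G xs)))))"
    by (intro recursive_intros recursive_comp2[OF binary_funpow] assms)
  moreover have "fst (prod_decode ((s ^^ n) (prod_encode (a, b)))) = (if n = 0 then a else b)" for n a b
  proof -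
    have "(s ^^ Suc n) (prod_encode (a, b)) = prod_encode (b, b)" for n
      by (induction n) (auto simp: s_def)
    then show ?thesis by (cases n) (auto simp del: funpow.simps(2))
  qed
  ultimately show ?thesis by simp
qed

section \<open>Effective functions between encoded types\<close>

class encodable =
  fixes encode :: "'a \<Rightarrow> nat"
  assumes encode_eq [simp]: "encode x = encode y \<longleftrightarrow> x = y"

instantiation nat :: encodable
begin
definition encode_nat :: "nat \<Rightarrow> nat" where [simp]: "encode_nat n = n"
instance by standard simp
end

instantiation bool :: encodable
begin
definition encode_bool :: "bool \<Rightarrow> nat" where [simp]: "encode_bool b = of_bool b"
instance by standard simp
end

instantiation prod :: (encodable, encodable) encodable
begin
definition encode_prod :: "'a \<times> 'b \<Rightarrow> nat" where
  "encode_prod p = prod_encode (encode (fst p), encode (snd p))"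
instance by standard (auto simp: encode_prod_def prod_eq_iff)
end

instantiation list :: (encodable) encodable
begin
definition encode_list :: "'a list \<Rightarrow> nat" where
  "encode_list xs = list_encode (map encode xs)"
instance by standard (auto simp: encode_list_def list_encode_eq inj_map_eq_map inj_def)
end

instantiation ty :: encodable
begin
definition encode_ty :: "ty \<Rightarrow> nat" where "encode_ty = enc_ty"
instance by standard (simp add: encode_ty_def)
end

instantiation tm :: encodable
begin
definition encode_tm :: "tm \<Rightarrow> nat" where "encode_tm = enc_tm"
instance by standard (simp add: encode_tm_def)
end

instantiation goal :: encodable
begin
definition encode_goal :: "goal \<Rightarrow> nat" where "encode_goal = enc_goal"
instance by standard (simp add: encode_goal_def)
end

instantiation clause :: encodable
begin
definition encode_clause :: "clause \<Rightarrow> nat" where "encode_clause = enc_clause"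
instance by standard (simp add: encode_clause_def)
end

instantiation problem :: encodable
begin
definition encode_problem :: "problem \<Rightarrow> nat" where "encode_problem = enc_problem"
instance by standard (simp add: encode_problem_def enc_problem_inject)
end

lemma encode_Pair [simp]: "encode (a, b) = prod_encode (encode a, encode b)"
  by (simp add: encode_prod_def)

lemma encode_list_simps [simp]:
  "encode [] = 0"
  "encode (x # xs) = Suc (prod_encode (encode x, encode xs))"
  by (simp_all add: encode_list_def)

lemma encode_ty_simps [simp]:
  "encode Iota = 0"
  "encode (Arrow \<gamma> \<delta>) = Suc (prod_encode (encode \<gamma>, encode \<delta>))"
  by (simp_all add: encode_ty_def)

lemma encode_tm_simps [simp]:
  "encode (Var i) = prod_encode (0, i)"
  "encode (Sym c) = prod_encode (1, c)"
  "encode (App s t) = prod_encode (2, prod_encode (encode s, encode t))"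
  by (simp_all add: encode_tm_def)

lemma encode_goal_simps [simp]:
  "encode (Atom P s) = prod_encode (0, prod_encode (P, encode s))"
  "encode (Conj G H) = prod_encode (1, prod_encode (encode G, encode H))"
  "encode (Exists \<gamma> G) = prod_encode (2, prod_encode (encode \<gamma>, encode G))"
  "encode Tru = prod_encode (3, 0)"
  by (simp_all add: encode_goal_def encode_ty_def encode_tm_def)

lemma encode_clause_simps [simp]:
  "encode (Clause \<gamma>s G P s) = list_encode [encode \<gamma>s, encode G, P, encode s]"
  by (simp add: encode_clause_def encode_goal_def encode_tm_def encode_list_def
      flip: encode_ty_def cong: map_cong)

lemma encode_problem_simps [simp]:
  "encode (Problem \<Sigma> \<Pi> D G) = list_encode [encode \<Sigma>, encode \<Pi>, encode D, encode G]"
proof -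
  have "map encode \<Sigma> = map (\<lambda>(c, \<gamma>). prod_encode (c, enc_ty \<gamma>)) \<Sigma>" "map encode \<Pi> = \<Pi>"
    by (auto simp: encode_prod_def encode_ty_def intro: map_idI)
  then show ?thesis
    by (simp add: encode_problem_def encode_goal_def encode_list_def encode_clause_def cong: map_cong)
qed

text \<open>
  The realizing function must be recursive on all numbers, also on those that encode no argument;
  this allows case distinctions to evaluate all of their branches.
\<close>

definition effective :: "('a :: encodable \<Rightarrow> 'b :: encodable) \<Rightarrow> bool" where
  "effective f \<longleftrightarrow> (\<exists>F. unary F \<and> (\<forall>x. F (encode x) = encode (f x)))"

lemma computable_if_effective: "effective f \<Longrightarrow> computable f"
  unfolding effective_def computable_def unary_iff encode_problem_def by metis

lemma effectiveI: "unary F \<Longrightarrow> (\<And>x. F (encode x) = encode (f x)) \<Longrightarrow> effective f"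
  unfolding effective_def by blast

text \<open>Stated as closure under substitution into any tuple, recursiveness of the realizer can
  be used like one of the \<open>recursive_intros\<close>.\<close>

lemma effectiveE:
  assumes "effective f"
  obtains F where "\<And>k G. recursive k G \<Longrightarrow> recursive k (\<lambda>xs. F (G xs))" "\<And>x. F (encode x) = encode (f x)"
  using assms unfolding effective_def by (metis recursive_comp1)

named_theorems effective_intros

lemma effective_id [effective_intros]: "effective (\<lambda>x. x)"
  by (rule effectiveI[where F = "\<lambda>n. n"]) (auto intro: recursive_intros)

lemma effective_const [effective_intros]: "effective (\<lambda>x. c)"
  by (rule effectiveI[where F = "\<lambda>n. encode c"]) (auto intro: recursive_intros)

text \<open>Only the code of the value matters, so a constructor is effective once its code
  coincides with that of a tuple, a list or a number already treated.\<close>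

lemma effective_recode:
  "effective f \<Longrightarrow> (\<And>x. encode (f x) = encode (g x)) \<Longrightarrow> effective g"
  unfolding effective_def by simp

lemma effective_comp: "effective g \<Longrightarrow> effective f \<Longrightarrow> effective (\<lambda>x. g (f x))"
proof -
  assume "effective g" "effective f"
  then obtain G F where GF: "unary G" "\<And>x. G (encode x) = encode (g x)" "unary F" "\<And>x. F (encode x) = encode (f x)"
    unfolding effective_def by blast
  show ?thesis
    by (rule effectiveI[OF recursive_comp1[OF GF(1,3)]]) (simp add: GF)
qed

lemma effective_unary:
  assumes "unary h" "effective f" "\<And>x. h (encode (f x)) = encode (g x)"
  shows "effective g"
proof -
  obtain F where F: "unary F" "\<And>x. F (encode x) = encode (f x)"
    using assms(2) unfolding effective_def by blast
  show ?thesis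
    by (rule effectiveI[OF recursive_comp1[OF assms(1) F(1)]]) (simp add: F assms(3))
qed

lemma effective_binary:
  assumes "binary h" "effective f" "effective f'" "\<And>x. h (encode (f x)) (encode (f' x)) = encode (g x)"
  shows "effective g"
proof -
  obtain F F' where "unary F" "\<And>x. F (encode x) = encode (f x)"
      "unary F'" "\<And>x. F' (encode x) = encode (f' x)"
    using assms(2,3) unfolding effective_def by blast
  then show ?thesis
    by (intro effectiveI[where F = "\<lambda>n. h (F n) (F' n)"]) (auto intro: recursive_comp2 assms simp: assms)
qed

lemma effective_encode [effective_intros]:
  "effective f \<Longrightarrow> effective (\<lambda>x. encode (f x))"
  by (erule effective_recode) simp

text \<open>On codes, decoding is the identity, and surjectivity makes every number a code. This
  later yields an effective enumeration of the types.\<close>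

lemma effective_inv_encode:
  assumes "surj (encode :: 'a :: encodable \<Rightarrow> nat)" "effective f"
  shows "effective (\<lambda>x. inv (encode :: 'a \<Rightarrow> nat) (f x))"
  by (rule effective_recode[OF assms(2)]) (simp add: surj_f_inv_f[OF assms(1)])

lemma effective_Suc [effective_intros]: "effective f \<Longrightarrow> effective (\<lambda>x. Suc (f x))"
  by (rule effective_unary[where h = Suc]) (auto intro: recursive_intros)

lemma effective_add [effective_intros]:
  assumes "effective f" "effective g"
  shows "effective (\<lambda>x. f x + g x :: nat)"
  by (rule effective_binary[where h = "(+)", OF _ assms]) (auto intro!: recursive_intros)

lemma effective_diff [effective_intros]:
  assumes "effective f" "effective g"
  shows "effective (\<lambda>x. f x - g x :: nat)"
  by (rule effective_binary[where h = "(-)", OF _ assms]) (auto intro!: recursive_intros)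

lemma effective_Pair [effective_intros]:
  assumes "effective f" "effective g"
  shows "effective (\<lambda>x. (f x, g x))"
  by (rule effective_binary[where h = "\<lambda>m n. prod_encode (m, n)", OF _ assms]) (auto intro!: recursive_intros)

lemma effective_fst [effective_intros]: "effective f \<Longrightarrow> effective (\<lambda>x. fst (f x))"
  by (rule effective_unary[where h = "\<lambda>n. fst (prod_decode n)"])
    (auto intro: recursive_intros simp: encode_prod_def)

lemma effective_snd [effective_intros]: "effective f \<Longrightarrow> effective (\<lambda>x. snd (f x))"
  by (rule effective_unary[where h = "\<lambda>n. snd (prod_decode n)"])
    (auto intro: recursive_intros simp: encode_prod_def)

lemma effective_case_prod [effective_intros]:
  "effective (\<lambda>x. h x (fst (f x)) (snd (f x))) \<Longrightarrow> effective (\<lambda>x. case f x of (a, b) \<Rightarrow> h x a b)"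
  by (simp add: case_prod_beta)

lemma effective_if [effective_intros]:
  assumes "effective b" "effective f" "effective g"
  shows "effective (\<lambda>x. if b x then f x else g x)"
proof -
  obtain B F G where "unary B" "\<And>x. B (encode x) = encode (b x)"
      "unary F" "\<And>x. F (encode x) = encode (f x)" "unary G" "\<And>x. G (encode x) = encode (g x)"
    using assms unfolding effective_def by blast
  then show ?thesis
    by (intro effectiveI[where F = "\<lambda>n. if B n = 0 then G n else F n"]) (auto intro: recursive_intros)
qed

lemma effective_is_zero: "effective f \<Longrightarrow> effective (\<lambda>x. f x = (0 :: nat))"
  by (rule effective_unary[where h = "\<lambda>n. if n = 0 then 1 else 0"]) (auto intro: recursive_intros)

lemma effective_eq [effective_intros]:
  assumes "effective f" "effective g"
  shows "effective (\<lambda>x. f x = g x)"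
proof -
  \<comment> \<open>By injectivity of \<open>encode\<close>, equality is equality of codes, that is,
    both truncated differences vanish.\<close>
  have "effective (\<lambda>x. encode (f x) - encode (g x) + (encode (g x) - encode (f x)) = 0)"
    by (intro effective_is_zero effective_intros assms)
  moreover have "m - n + (n - m) = 0 \<longleftrightarrow> m = n" for m n :: nat by auto
  ultimately show ?thesis by (simp only: encode_eq)
qed

lemma effective_disj [effective_intros]:
  assumes "effective p" "effective q"
  shows "effective (\<lambda>x. p x \<or> q x)"
proof -
  have "effective (\<lambda>x. if p x then True else q x)"
    by (intro effective_intros assms)
  moreover have "(if a then True else b) = (a \<or> b)" for a b by simp
  ultimately show ?thesis by (simp only:)
qed

text \<open>The realizer iterates on a pair whose first component keeps the parameter
  \<open>x\<close> while the second is updated. This turns iteration with a parameter into iteration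
  of a unary function.\<close>

lemma effective_funpow [effective_intros]:
  fixes h :: "'a :: encodable \<Rightarrow> 'b :: encodable \<Rightarrow> 'b"
  assumes h: "effective (\<lambda>p. h (fst p) (snd p))" and "effective n" "effective a"
  shows "effective (\<lambda>x. (h x ^^ n x) (a x))"
proof -
  obtain H where H: "\<And>k G. recursive k G \<Longrightarrow> recursive k (\<lambda>xs. H (G xs))"
      "\<And>x y. H (prod_encode (encode x, encode y)) = encode (h x y)"
    using h by (elim effectiveE) (metis encode_Pair fst_conv snd_conv)
  obtain N where N: "\<And>k G. recursive k G \<Longrightarrow> recursive k (\<lambda>xs. N (G xs))" "\<And>x. N (encode x) = n x"
    using assms(2) by (elim effectiveE) auto
  obtain A where A: "\<And>k G. recursive k G \<Longrightarrow> recursive k (\<lambda>xs. A (G xs))" "\<And>x. A (encode x) = encode (a x)"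
    using assms(3) by (elim effectiveE) auto
  define s where "s z = prod_encode (fst (prod_decode z), H z)" for z
  have s: "unary s"
    unfolding s_def by (intro recursive_intros H) auto
  have *: "(s ^^ m) (prod_encode (encode x, encode y)) = prod_encode (encode x, encode ((h x ^^ m) y))" for m x y
    by (induction m) (simp_all add: s_def H)
  show ?thesis
    by (rule effectiveI[where F = "\<lambda>z. snd (prod_decode ((s ^^ N z) (prod_encode (z, A z))))"])
      (auto intro!: recursive_intros N A recursive_comp2[OF binary_funpow[OF s]] simp: N A *)
qed

section \<open>Effective operations on lists\<close>

lemma effective_Cons [effective_intros]:
  assumes "effective f" "effective g"
  shows "effective (\<lambda>x. f x # g x)"
proof (rule effective_recode)
  show "effective (\<lambda>x. Suc (encode (f x, g x)))" by (intro effective_intros assms)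
qed simp

lemma effective_case_list [effective_intros]:
  assumes "effective l" "effective g" "effective (\<lambda>p. h (fst p) (fst (snd p)) (snd (snd p)))"
  shows "effective (\<lambda>x. case l x of [] \<Rightarrow> g x | y # ys \<Rightarrow> h x y ys)"
proof -
  obtain L where L: "\<And>k G. recursive k G \<Longrightarrow> recursive k (\<lambda>xs. L (G xs))" "\<And>x. L (encode x) = encode (l x)"
    using assms(1) by (elim effectiveE) auto
  obtain G where G: "\<And>k F. recursive k F \<Longrightarrow> recursive k (\<lambda>xs. G (F xs))" "\<And>x. G (encode x) = encode (g x)"
    using assms(2) by (elim effectiveE) auto
  obtain H where H: "\<And>k G. recursive k G \<Longrightarrow> recursive k (\<lambda>xs. H (G xs))"
      "\<And>x y ys. H (prod_encode (encode x, prod_encode (encode y, encode ys))) = encode (h x y ys)"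
    using assms(3) by (elim effectiveE) (metis encode_Pair fst_conv snd_conv)
  show ?thesis
    \<comment> \<open>The empty list has code 0; otherwise the predecessor of the code is the pair
      of head and tail.\<close>
    by (rule effectiveI[where F = "\<lambda>n. if L n = 0 then G n else H (prod_encode (n, L n - 1))"])
      (auto intro!: recursive_intros L G H simp: L G H split: list.split)
qed

lemma length_le_encode: "length xs \<le> encode xs"
proof (induction xs)
  case (Cons x xs)
  then show ?case using le_prod_encode_2[of "encode xs" "encode x"] by simp
qed simp

text \<open>A fold becomes a bounded iteration: each step removes one element from the remaining
  list and applies \<open>h x\<close>. The code of the list serves as the number of steps, being at
  least its length; once the list is empty, further steps change nothing.\<close>

lemma effective_fold [effective_intros]:
  assumes h: "effective (\<lambda>p. h (fst p) (fst (snd p)) (snd (snd p)))" and "effective l" "effective a"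
  shows "effective (\<lambda>x. fold (h x) (l x) (a x))"
proof -
  define s where "s x = (\<lambda>(ys, b). case ys of [] \<Rightarrow> ([], b) | y # ys \<Rightarrow> (ys, h x y b))" for x
  have s: "(s x ^^ n) (ys, b) = ([], fold (h x) ys b)" if "length ys \<le> n" for n x ys b
    using that
  proof (induction n arbitrary: ys b)
    case (Suc n)
    show ?case
    proof (cases ys)
      case Nil
      then show ?thesis using Suc.IH[of "[]"] by (simp add: s_def funpow_swap1)
    next
      case (Cons y ys')
      then show ?thesis using Suc by (simp add: s_def funpow_swap1)
    qed
  qed simp
  have "effective (\<lambda>p. h (fst (fst p)) (fst (snd p)) (snd (snd (fst p))))"
    by (rule effective_comp[OF h, of "\<lambda>p. (fst (fst p), fst (snd p), snd (snd (fst p)))", simplified])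
      (intro effective_intros)
  then have "effective (\<lambda>x. snd ((s x ^^ encode (l x)) (l x, a x)))"
    unfolding s_def by (intro effective_intros assms)
  then show ?thesis by (simp add: s length_le_encode)
qed

lemma effective_rev [effective_intros]:
  assumes "effective l"
  shows "effective (\<lambda>x. rev (l x))"
proof -
  have "effective (\<lambda>x. fold (\<lambda>y ys. y # ys) (l x) [])"
    by (intro effective_intros assms)
  then show ?thesis by (simp add: fold_Cons_rev)
qed

lemma effective_append [effective_intros]:
  assumes "effective l" "effective m"
  shows "effective (\<lambda>x. l x @ m x)"
proof -
  have "effective (\<lambda>x. fold (\<lambda>y ys. y # ys) (rev (l x)) (m x))"
    by (intro effective_intros assms)
  then show ?thesis by (simp add: fold_Cons_rev)
qed

lemma effective_foldl [effective_intros]: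
  assumes "effective (\<lambda>p. h (fst p) (snd (snd p)) (fst (snd p)))" "effective l" "effective a"
  shows "effective (\<lambda>x. foldl (h x) (a x) (l x))"
  unfolding foldl_conv_fold by (intro effective_intros assms)

lemma effective_foldr [effective_intros]:
  assumes "effective (\<lambda>p. h (fst p) (fst (snd p)) (snd (snd p)))" "effective l" "effective a"
  shows "effective (\<lambda>x. foldr (h x) (l x) (a x))"
  unfolding foldr_conv_fold by (intro effective_intros assms)

lemma effective_map [effective_intros]:
  fixes h :: "'a :: encodable \<Rightarrow> 'b :: encodable \<Rightarrow> 'c :: encodable"
  assumes h: "effective (\<lambda>p. h (fst p) (snd p))" and l: "effective l"
  shows "effective (\<lambda>x. map (h x) (l x))"
proof -
  have *: "foldr (\<lambda>y ys. f y # ys) xs [] = map f xs" for f :: "'b \<Rightarrow> 'c" and xs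
    by (induction xs) auto
  have "effective (\<lambda>p. h (fst p) (fst (snd p)))"
    by (rule effective_comp[OF h, of "\<lambda>p. (fst p, fst (snd p))", simplified]) (intro effective_intros)
  then have "effective (\<lambda>x. foldr (\<lambda>y ys. h x y # ys) (l x) [])"
    by (intro effective_intros l)
  then show ?thesis by (simp only: *)
qed

lemma effective_length [effective_intros]:
  assumes "effective l"
  shows "effective (\<lambda>x. length (l x))"
proof -
  have *: "foldr (\<lambda>y n. Suc n) xs 0 = length xs" for xs :: "'c list"
    by (induction xs) auto
  have "effective (\<lambda>x. foldr (\<lambda>y n. Suc n) (l x) 0)"
    by (intro effective_intros assms)
  then show ?thesis by (simp only: *)
qed

lemma effective_elem [effective_intros]:
  assumes "effective a" "effective l"
  shows "effective (\<lambda>x. a x \<in> set (l x))"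
proof -
  have *: "foldr (\<lambda>y b. z = y \<or> b) xs False \<longleftrightarrow> z \<in> set xs" for z and xs :: "'c list"
    by (induction xs) auto
  have "effective (\<lambda>p. a (fst p))"
    by (rule effective_comp[OF assms(1)]) (intro effective_intros)
  then have "effective (\<lambda>x. foldr (\<lambda>y b. a x = y \<or> b) (l x) False)"
    by (intro effective_intros assms)
  then show ?thesis by (simp only: *)
qed

lemma effective_upt [effective_intros]:
  assumes "effective n"
  shows "effective (\<lambda>x. [0..<n x])"
proof -
  \<comment> \<open>The length of the list built so far is the next number to append, so no separate
    counter is kept.\<close>
  have "((\<lambda>l. l @ [length l]) ^^ k) [] = [0..<k]" for k by (induction k) auto
  moreover have "effective (\<lambda>x. ((\<lambda>l. l @ [length l]) ^^ n x) [])"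
    by (intro effective_intros assms)
  ultimately show ?thesis by simp
qed

section \<open>Effective constructors and case distinctions for the syntax\<close>

lemma effective_Arrow [effective_intros]:
  assumes "effective f" "effective g"
  shows "effective (\<lambda>x. Arrow (f x) (g x))"
proof (rule effective_recode)
  show "effective (\<lambda>x. Suc (encode (f x, g x)))" by (intro effective_intros assms)
qed simp

lemma effective_Var [effective_intros]:
  assumes "effective f"
  shows "effective (\<lambda>x. Var (f x))"
proof (rule effective_recode)
  show "effective (\<lambda>x. (0 :: nat, f x))" by (intro effective_intros assms)
qed simp

lemma effective_Sym [effective_intros]:
  assumes "effective f"
  shows "effective (\<lambda>x. Sym (f x))"
proof (rule effective_recode)
  show "effective (\<lambda>x. (1 :: nat, f x))" by (intro effective_intros assms)
qed simp

lemma effective_App [effective_intros]: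
  assumes "effective f" "effective g"
  shows "effective (\<lambda>x. App (f x) (g x))"
proof (rule effective_recode)
  show "effective (\<lambda>x. (2 :: nat, f x, g x))" by (intro effective_intros assms)
qed simp

lemma effective_arrows [effective_intros]:
  "effective l \<Longrightarrow> effective f \<Longrightarrow> effective (\<lambda>x. arrows (l x) (f x))"
  unfolding arrows_def by (intro effective_intros)

lemma effective_apps [effective_intros]:
  "effective f \<Longrightarrow> effective l \<Longrightarrow> effective (\<lambda>x. apps (f x) (l x))"
  unfolding apps_def by (intro effective_intros)

lemma effective_Atom [effective_intros]:
  assumes "effective f" "effective g"
  shows "effective (\<lambda>x. Atom (f x) (g x))"
proof (rule effective_recode)
  show "effective (\<lambda>x. (0 :: nat, f x, g x))" by (intro effective_intros assms)
qed simp

lemma effective_Conj [effective_intros]: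
  assumes "effective f" "effective g"
  shows "effective (\<lambda>x. Conj (f x) (g x))"
proof (rule effective_recode)
  show "effective (\<lambda>x. (1 :: nat, f x, g x))" by (intro effective_intros assms)
qed simp

lemma effective_case_goal [effective_intros]:
  assumes "effective g"
    and "effective (\<lambda>p. a (fst p) (fst (snd p)) (snd (snd p)))"
    and "effective (\<lambda>p. c (fst p) (fst (snd p)) (snd (snd p)))"
    and "effective (\<lambda>p. e (fst p) (fst (snd p)) (snd (snd p)))"
    and "effective t"
  shows "effective (\<lambda>x. case g x of Atom P s \<Rightarrow> a x P s | Conj G H \<Rightarrow> c x G H
    | Exists \<gamma> G \<Rightarrow> e x \<gamma> G | Tru \<Rightarrow> t x)"
proof -
  obtain G where G: "\<And>k F. recursive k F \<Longrightarrow> recursive k (\<lambda>xs. G (F xs))" "\<And>x. G (encode x) = encode (g x)"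
    using assms(1) by (elim effectiveE) auto
  obtain A where A: "\<And>k F. recursive k F \<Longrightarrow> recursive k (\<lambda>xs. A (F xs))"
      "\<And>x P s. A (prod_encode (encode x, prod_encode (P, encode s))) = encode (a x P s)"
    using assms(2) by (elim effectiveE) (metis encode_Pair fst_conv snd_conv encode_nat_def)
  obtain C where C: "\<And>k F. recursive k F \<Longrightarrow> recursive k (\<lambda>xs. C (F xs))"
      "\<And>x G H. C (prod_encode (encode x, prod_encode (encode G, encode H))) = encode (c x G H)"
    using assms(3) by (elim effectiveE) (metis encode_Pair fst_conv snd_conv)
  obtain E where E: "\<And>k F. recursive k F \<Longrightarrow> recursive k (\<lambda>xs. E (F xs))"
      "\<And>x \<gamma> G. E (prod_encode (encode x, prod_encode (encode \<gamma>, encode G))) = encode (e x \<gamma> G)"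
    using assms(4) by (elim effectiveE) (metis encode_Pair fst_conv snd_conv)
  obtain T where T: "\<And>k F. recursive k F \<Longrightarrow> recursive k (\<lambda>xs. T (F xs))" "\<And>x. T (encode x) = encode (t x)"
    using assms(5) by (elim effectiveE) auto
  show ?thesis
    \<comment> \<open>The tags 0, 1 and 2 are tested in turn by truncated subtraction, each test
      relying on the earlier ones having removed the smaller tags. \<open>Tru\<close>, with tag 3,
      falls into the last branch.\<close>
    by (rule effectiveI[where F = "\<lambda>n.
          if fst (prod_decode (G n)) = 0 then A (prod_encode (n, snd (prod_decode (G n))))
          else if fst (prod_decode (G n)) - 1 = 0 then C (prod_encode (n, snd (prod_decode (G n))))
          else if fst (prod_decode (G n)) - 2 = 0 then E (prod_encode (n, snd (prod_decode (G n))))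
          else T n"])
      (auto intro!: recursive_intros G A C E T simp: G A C E T simp del: diff_is_0_eq diff_is_0_eq' split: goal.split)
qed

lemma effective_Clause [effective_intros]:
  assumes "effective l" "effective f" "effective g" "effective h"
  shows "effective (\<lambda>x. Clause (l x) (f x) (g x) (h x))"
proof (rule effective_recode)
  show "effective (\<lambda>x. [encode (l x), encode (f x), g x, encode (h x)])"
    by (intro effective_intros assms)
qed simp

lemma effective_Problem [effective_intros]:
  assumes "effective l" "effective f" "effective g" "effective h"
  shows "effective (\<lambda>x. Problem (l x) (f x) (g x) (h x))"
proof (rule effective_recode)
  show "effective (\<lambda>x. [encode (l x), encode (f x), encode (g x), encode (h x)])"
    by (intro effective_intros assms)
qed simp

text \<open>The code of a nonempty list is the successor of the pair of head and tail, so dropping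
  \<open>i\<close> elements and reading the head is arithmetic on the code.\<close>

definition code_nth :: "nat \<Rightarrow> nat \<Rightarrow> nat" where
  "code_nth i n = fst (prod_decode (((\<lambda>m. snd (prod_decode (m - 1))) ^^ i) n - 1))"

lemma recursive_code_nth: "unary (code_nth i)"
proof -
  have "unary ((\<lambda>m. snd (prod_decode (m - 1))) ^^ i)"
    by (induction i) (auto intro!: recursive_intros)
  then show ?thesis
    unfolding code_nth_def by (intro recursive_intros)
qed

lemma code_nth_list_encode: "i < length xs \<Longrightarrow> code_nth i (list_encode xs) = xs ! i"
proof (induction xs arbitrary: i)
  case (Cons x xs)
  then show ?case
    by (cases i) (auto simp: code_nth_def funpow_Suc_right simp del: funpow.simps(2))
qed simp

text \<open>Clauses and problems are encoded as lists of four codes, so their selectors extract a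
  fixed entry.\<close>

lemma effective_component:
  assumes "effective f" "\<And>x. \<exists>ns. encode (f x) = list_encode ns \<and> i < length ns \<and> encode (g x) = ns ! i"
  shows "effective g"
  using effective_unary[OF recursive_code_nth assms(1)] assms(2) by (metis code_nth_list_encode)

lemma effective_problem_selectors [effective_intros]:
  assumes "effective f"
  shows "effective (\<lambda>x. funs (f x))" "effective (\<lambda>x. preds (f x))"
    "effective (\<lambda>x. defn (f x))" "effective (\<lambda>x. query (f x))"
proof -
  have *: "encode I = list_encode [encode (funs I), encode (preds I), encode (defn I), encode (query I)]" for I
    by (cases I) simp
  show "effective (\<lambda>x. funs (f x))"
    by (rule effective_component[OF assms, where i = 0], intro exI conjI, rule *) simp_all
  show "effective (\<lambda>x. preds (f x))"
    by (rule effective_component[OF assms, where i = 1], intro exI conjI, rule *) simp_all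
  show "effective (\<lambda>x. defn (f x))"
    by (rule effective_component[OF assms, where i = 2], intro exI conjI, rule *) simp_all
  show "effective (\<lambda>x. query (f x))"
    by (rule effective_component[OF assms, where i = 3], intro exI conjI, rule *) simp_all
qed

lemma effective_case_clause [effective_intros]:
  assumes "effective c"
    and h: "effective (\<lambda>p. h (fst p) (fst (snd p)) (fst (snd (snd p))) (fst (snd (snd (snd p)))) (snd (snd (snd (snd p)))))"
  shows "effective (\<lambda>x. case c x of Clause \<gamma>s G P s \<Rightarrow> h x \<gamma>s G P s)"
proof -
  define \<gamma>s G P s where sel: "\<gamma>s C = (case C of Clause \<gamma>s G P s \<Rightarrow> \<gamma>s)"
      "G C = (case C of Clause \<gamma>s G P s \<Rightarrow> G)" "P C = (case C of Clause \<gamma>s G P s \<Rightarrow> P)"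
      "s C = (case C of Clause \<gamma>s G P s \<Rightarrow> s)" for C
  have *: "encode C = list_encode [encode (\<gamma>s C), encode (G C), encode (P C), encode (s C)]" for C
    by (cases C) (simp add: sel)
  have "effective (\<lambda>x. \<gamma>s (c x))"
    by (rule effective_component[OF assms(1), where i = 0], intro exI conjI, rule *) simp_all
  moreover have "effective (\<lambda>x. G (c x))"
    by (rule effective_component[OF assms(1), where i = 1], intro exI conjI, rule *) simp_all
  moreover have "effective (\<lambda>x. P (c x))"
    by (rule effective_component[OF assms(1), where i = 2], intro exI conjI, rule *) simp_all
  moreover have "effective (\<lambda>x. s (c x))"
    by (rule effective_component[OF assms(1), where i = 3], intro exI conjI, rule *) simp_all
  ultimately have "effective (\<lambda>x. (x, \<gamma>s (c x), G (c x), P (c x), s (c x)))"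
    by (intro effective_intros)
  from effective_comp[OF h this]
  have "effective (\<lambda>x. h x (\<gamma>s (c x)) (G (c x)) (P (c x)) (s (c x)))"
    by simp
  moreover have "(case c x of Clause \<gamma>s G P s \<Rightarrow> h x \<gamma>s G P s) = h x (\<gamma>s (c x)) (G (c x)) (P (c x)) (s (c x))" for x
    by (cases "c x") (simp add: sel)
  ultimately show ?thesis by simp
qed

section \<open>Terms, typing and substitution\<close>

lemma apps_simps [simp]: "apps s [] = s" "apps s (t # ts) = apps (App s t) ts"
  by (simp_all add: apps_def)

lemma apps_append [simp]: "apps s (ts @ us) = apps (apps s ts) us"
  by (simp add: apps_def)

lemma arrows_simps [simp]: "arrows [] \<delta> = \<delta>" "arrows (\<gamma> # \<gamma>s) \<delta> = Arrow \<gamma> (arrows \<gamma>s \<delta>)"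
  by (simp_all add: arrows_def)

lemma arrows_eq_iff: "arrows \<gamma>s Iota = arrows \<delta>s Iota \<longleftrightarrow> \<gamma>s = \<delta>s"
proof (induction \<gamma>s arbitrary: \<delta>s)
  case Nil
  show ?case by (cases \<delta>s) auto
next
  case (Cons \<gamma> \<gamma>s)
  then show ?case by (cases \<delta>s) auto
qed

lemma apps_Sym_neq_Sym: "apps (App s t) ts \<noteq> Sym c"
  by (induction ts arbitrary: s t) auto

lemma apps_Sym_eq_iff [simp]: "apps (Sym c) ts = apps (Sym d) us \<longleftrightarrow> c = d \<and> ts = us"
proof (induction ts arbitrary: us rule: rev_induct)
  case Nil
  show ?case using apps_Sym_neq_Sym by (cases us) (auto, metis)
next
  case (snoc t ts)
  then show ?case by (cases us rule: rev_cases) auto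
qed

lemma has_type_mono: "has_type \<Sigma> \<Gamma> t \<gamma> \<Longrightarrow> set \<Sigma> \<subseteq> set \<Sigma>' \<Longrightarrow> has_type \<Sigma>' \<Gamma> t \<gamma>"
  by (induction rule: has_type.induct) (auto intro: has_type.intros)

lemma list_all2_closed_mono:
  "list_all2 (closed_term \<Sigma>) ts \<gamma>s \<Longrightarrow> set \<Sigma> \<subseteq> set \<Sigma>' \<Longrightarrow> list_all2 (closed_term \<Sigma>') ts \<gamma>s"
  by (erule list_all2_mono) (rule has_type_mono)

lemma has_type_apps:
  "has_type \<Sigma> \<Gamma> s (arrows \<gamma>s \<delta>) \<Longrightarrow> list_all2 (has_type \<Sigma> \<Gamma>) ts \<gamma>s \<Longrightarrow> has_type \<Sigma> \<Gamma> (apps s ts) \<delta>"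
proof (induction \<gamma>s arbitrary: s ts)
  case (Cons \<gamma> \<gamma>s)
  then obtain u us where ts: "ts = u # us" "has_type \<Sigma> \<Gamma> u \<gamma>" "list_all2 (has_type \<Sigma> \<Gamma>) us \<gamma>s"
    by (auto simp: list_all2_Cons2)
  moreover have "has_type \<Sigma> \<Gamma> (App s u) (arrows \<gamma>s \<delta>)"
    using Cons.prems(1) ts(2) by (auto intro: has_type.intros(3))
  ultimately show ?case using Cons.IH by simp
qed simp

lemma has_type_appsE:
  assumes "has_type \<Sigma> \<Gamma> (apps s ts) \<delta>"
  obtains \<gamma>s where "has_type \<Sigma> \<Gamma> s (arrows \<gamma>s \<delta>)" "list_all2 (has_type \<Sigma> \<Gamma>) ts \<gamma>s"
  using assms
proof (induction ts arbitrary: s thesis)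
  case Nil
  then show ?case using Nil(1)[of "[]"] by simp
next
  case (Cons t ts)
  from Cons.prems(2) have "has_type \<Sigma> \<Gamma> (apps (App s t) ts) \<delta>" by simp
  then obtain \<gamma>s where *: "has_type \<Sigma> \<Gamma> (App s t) (arrows \<gamma>s \<delta>)" "list_all2 (has_type \<Sigma> \<Gamma>) ts \<gamma>s"
    by (rule Cons.IH[rotated])
  from *(1) obtain \<gamma> where "has_type \<Sigma> \<Gamma> s (Arrow \<gamma> (arrows \<gamma>s \<delta>))" "has_type \<Sigma> \<Gamma> t \<gamma>"
    by (cases rule: has_type.cases) auto
  then show ?case using Cons.prems(1)[of "\<gamma> # \<gamma>s"] *(2) by simp
qed

text \<open>Names are declared once, so the head symbol has a unique type, from which its argument
  types can be read off. Soundness uses this to infer from the head of a clause instance alone that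
  all substituted terms are closed over \<open>\<Sigma>\<close>.\<close>

lemma closed_args:
  assumes "distinct (map fst \<Sigma>)" "(c, arrows \<gamma>s Iota) \<in> set \<Sigma>"
    and "closed_term \<Sigma> (apps (Sym c) ts) Iota"
  shows "list_all2 (closed_term \<Sigma>) ts \<gamma>s"
proof -
  obtain \<delta>s where \<delta>s: "closed_term \<Sigma> (Sym c) (arrows \<delta>s Iota)" "list_all2 (closed_term \<Sigma>) ts \<delta>s"
    using assms(3) by (rule has_type_appsE)
  then have "(c, arrows \<delta>s Iota) \<in> set \<Sigma>"
    by (auto elim: has_type.cases)
  then have "arrows \<delta>s Iota = arrows \<gamma>s Iota"
    using assms(1,2) by (metis eq_key_imp_eq_value)
  then show ?thesis using \<delta>s(2) by (simp add: arrows_eq_iff)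
qed

lemma has_type_Var: "i < length \<Gamma> \<Longrightarrow> \<gamma> = \<Gamma> ! i \<Longrightarrow> has_type \<Sigma> \<Gamma> (Var i) \<gamma>"
  by (auto intro: has_type.intros)

lemma has_type_vars:
  "list_all2 (has_type \<Sigma> (\<Gamma> @ \<Delta>)) (map Var [0..<length \<Gamma>]) \<Gamma>"
  by (auto simp: list_all2_conv_all_nth nth_append intro!: has_type_Var)

lemma subst_apps [simp]: "subst \<sigma> (apps s ts) = apps (subst \<sigma> s) (map (subst \<sigma>) ts)"
  by (induction ts arbitrary: s) auto

lemma inst_Cons_0 [simp]: "inst (t # ts) 0 = t"
  by (simp add: inst_def)

lemma inst_Cons_Suc [simp]: "inst (t # ts) (Suc i) = inst ts i"
  by (simp add: inst_def)

lemma inst_Nil [simp]: "inst [] = Var"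
  by (simp add: inst_def fun_eq_iff)

text \<open>The surplus \<open>us\<close> covers the clauses for quantified bodies, where the
  witness is an additional last variable.\<close>

lemma map_inst_vars: "length ts = n \<Longrightarrow> map (\<lambda>i. inst (ts @ us) i) [0..<n] = ts"
  by (auto simp: inst_def nth_append intro!: nth_equalityI)

lemma has_type_subst:
  assumes "has_type \<Sigma> \<Gamma> s \<gamma>" "list_all2 (closed_term \<Sigma>) ts \<Gamma>"
  shows "closed_term \<Sigma> (subst (inst ts) s) \<gamma>"
  using assms by (induction rule: has_type.induct)
    (auto simp: inst_def list_all2_conv_all_nth intro: has_type.intros)

lemma subst_subst: "subst \<sigma> (subst \<tau> s) = subst (\<lambda>i. subst \<sigma> (\<tau> i)) s"
  by (induction s) auto

lemma subst_Var [simp]: "subst Var s = s"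
  by (induction s) auto

lemma lift_Var [simp]: "lift Var = Var"
  by (auto simp: lift_def split: nat.split)

lemma subst_goal_Var [simp]: "subst_goal Var G = G"
  by (induction G) auto

lemma lift_comp: "(\<lambda>i. subst (lift \<sigma>) (lift \<tau> i)) = lift (\<lambda>i. subst \<sigma> (\<tau> i))"
  by (auto simp: lift_def subst_subst split: nat.split)

lemma subst_goal_subst_goal:
  "subst_goal \<sigma> (subst_goal \<tau> G) = subst_goal (\<lambda>i. subst \<sigma> (\<tau> i)) G"
  by (induction G arbitrary: \<sigma> \<tau>) (auto simp: subst_subst lift_comp)

text \<open>\<open>lift\<close> shifts the terms \<open>ts\<close> past the binder and
  \<open>inst [t]\<close> undoes the shift. The resulting simultaneous instantiation has the witness
  at index 0, as fits the child context \<open>\<gamma> # \<Gamma>\<close>.\<close>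

lemma subst_goal_inst_lift:
  "subst_goal (inst [t]) (subst_goal (lift (inst ts)) G) = subst_goal (inst (t # ts)) G"
proof -
  have "subst (inst [t]) (lift (inst ts) i) = inst (t # ts) i" for i
    by (cases i) (simp_all add: lift_def subst_subst)
  then show ?thesis by (simp add: subst_goal_subst_goal)
qed

section \<open>Subgoal occurrences\<close>

type_synonym occurrence = "ty list \<times> goal"

definition children :: "occurrence \<Rightarrow> occurrence list" where
  "children = (\<lambda>(\<Gamma>, G). case G of Atom P s \<Rightarrow> [] | Conj H K \<Rightarrow> [(\<Gamma>, H), (\<Gamma>, K)]
     | Exists \<gamma> H \<Rightarrow> [(\<gamma> # \<Gamma>, H)] | Tru \<Rightarrow> [])"

text \<open>A work list replaces structural recursion, so that the traversal iterates one effective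
  step. Skipping occurrences already seen keeps the result free of duplicates, so that each fresh
  symbol is declared once.\<close>

definition visit :: "occurrence list \<times> occurrence list \<Rightarrow> occurrence list \<times> occurrence list" where
  "visit = (\<lambda>(todo, seen). case todo of [] \<Rightarrow> ([], seen)
     | x # xs \<Rightarrow> if x \<in> set seen then (xs, seen) else (children x @ xs, x # seen))"

text \<open>The code of the work list bounds the number of subgoals still to be visited.\<close>

definition occurrences :: "occurrence list \<Rightarrow> occurrence list" where
  "occurrences xs = snd ((visit ^^ encode xs) (xs, []))"

text \<open>Termination measure of the traversal. It ignores contexts, since these grow below an
  existential quantifier.\<close>

definition weight :: "occurrence list \<Rightarrow> nat" where
  "weight xs = (\<Sum>x\<leftarrow>xs. Suc (encode (snd x)))"

lemma prod_encode_ge_add: "a + b \<le> prod_encode (a, b)"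
  using triangle_ge[of "a + b"] by (simp add: prod_encode_def)

lemma weight_children: "weight (children x) < Suc (encode (snd x))"
proof -
  \<comment> \<open>A positive tag adds at least 2 to the code; for a conjunction this pays for the
    two successors in the weight of its children.\<close>
  have *: "b + 2 \<le> prod_encode (Suc n, b)" for n b
    by (simp add: prod_encode_def)
  obtain \<Gamma> G where x: "x = (\<Gamma>, G)" by (cases x)
  show ?thesis
  proof (cases G)
    case (Conj H K)
    then show ?thesis
      using *[of "prod_encode (encode H, encode K)" 0] prod_encode_ge_add[of "encode H" "encode K"]
      by (simp add: x weight_def children_def)
  next
    case (Exists \<gamma> H)
    then show ?thesis
      using *[of "prod_encode (encode \<gamma>, encode H)" 1] prod_encode_ge_add[of "encode \<gamma>" "encode H"]
      by (simp add: x weight_def children_def numeral_2_eq_2)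
  qed (simp_all add: x weight_def children_def)
qed

lemma weight_le_encode: "weight xs \<le> encode xs"
proof (induction xs)
  case (Cons x xs)
  have "encode (snd x) + encode xs \<le> prod_encode (encode x, encode xs)"
    using prod_encode_ge_add[of "encode x" "encode xs"] le_prod_encode_2[of "encode (snd x)" "encode (fst x)"]
    by (simp add: encode_prod_def)
  with Cons show ?case by (simp add: weight_def)
qed (simp add: weight_def)

text \<open>\<open>P\<close> is any property inherited by children: the trivial one gives the
  closure properties of the result, other choices give induction over it. The last conjunct charges
  one unit of weight to each step as long as work remains.\<close>

lemma visit_invariant:
  assumes "(visit ^^ n) (xs, []) = (todo, seen)"
    and P: "\<forall>x \<in> set xs. P x" "\<forall>x. P x \<longrightarrow> (\<forall>y \<in> set (children x). P y)"
  shows "distinct seen \<and> set xs \<subseteq> set todo \<union> set seen \<and>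
    (\<forall>x \<in> set seen. set (children x) \<subseteq> set todo \<union> set seen) \<and>
    (\<forall>x \<in> set todo \<union> set seen. P x) \<and> (todo = [] \<or> weight todo + n \<le> weight xs)"
  using assms(1)
proof (induction n arbitrary: todo seen)
  case 0
  then show ?case using P(1) by simp
next
  case (Suc n)
  obtain todo' seen' where *: "(visit ^^ n) (xs, []) = (todo', seen')" by fastforce
  note IH = Suc.IH[OF *]
  have v: "visit (todo', seen') = (todo, seen)" using Suc.prems * by simp
  show ?case
  proof (cases todo')
    case Nil
    then show ?thesis using IH v by (simp add: visit_def)
  next
    case (Cons x ys)
    show ?thesis
    proof (cases "x \<in> set seen'")
      case True
      then show ?thesis using IH v Cons by (auto simp: visit_def weight_def)
    next
      case False
      then have "todo = children x @ ys" "seen = x # seen'"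
        using v Cons by (auto simp: visit_def)
      moreover have "weight (children x @ ys) < weight todo'"
        using weight_children[of x] Cons by (simp add: weight_def)
      moreover have "P x" using IH Cons by simp
      then have "\<forall>y \<in> set (children x). P y" using P(2) by blast
      ultimately show ?thesis using IH Cons False by auto
    qed
  qed
qed

lemma
  shows distinct_occurrences: "distinct (occurrences xs)"
    and roots_occurrences: "set xs \<subseteq> set (occurrences xs)"
    and children_occurrences: "x \<in> set (occurrences xs) \<Longrightarrow> set (children x) \<subseteq> set (occurrences xs)"
    and occurrences_induct: "x \<in> set (occurrences xs) \<Longrightarrow> (\<And>x. x \<in> set xs \<Longrightarrow> P x) \<Longrightarrow>
      (\<And>x y. P x \<Longrightarrow> y \<in> set (children x) \<Longrightarrow> P y) \<Longrightarrow> P x"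
proof -
  obtain todo seen where *: "(visit ^^ encode xs) (xs, []) = (todo, seen)" by fastforce
  have seen: "occurrences xs = seen" using * by (simp add: occurrences_def)
  \<comment> \<open>Remaining work would have positive weight, but \<open>encode xs\<close> steps
    have used up the initial weight, which is at most \<open>encode xs\<close>.\<close>
  have todo: "todo = []"
  proof (rule ccontr)
    assume "todo \<noteq> []"
    moreover from this have "weight todo > 0" by (cases todo) (auto simp: weight_def)
    ultimately show False
      using visit_invariant[OF *, of "\<lambda>_. True"] weight_le_encode[of xs] by auto
  qed
  show "distinct (occurrences xs)" "set xs \<subseteq> set (occurrences xs)"
    "x \<in> set (occurrences xs) \<Longrightarrow> set (children x) \<subseteq> set (occurrences xs)"
    using visit_invariant[OF *, of "\<lambda>_. True"] by (auto simp: seen todo)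
  show "P x" if "x \<in> set (occurrences xs)" "\<And>x. x \<in> set xs \<Longrightarrow> P x"
    "\<And>x y. P x \<Longrightarrow> y \<in> set (children x) \<Longrightarrow> P y"
  proof -
    have "\<forall>x \<in> set todo \<union> set seen. P x"
      using visit_invariant[OF *, of P] that(2,3) by blast
    then show ?thesis using that(1) seen by simp
  qed
qed

lemma effective_occurrences [effective_intros]:
  assumes "effective f"
  shows "effective (\<lambda>x. occurrences (f x))"
  unfolding occurrences_def visit_def children_def by (intro effective_intros assms)

section \<open>The reduction\<close>

text \<open>
  All fresh symbols are numbered from \<open>N\<close> on, a number above all symbols of the given problem, and
  \<open>N\<close> itself serves as the fresh predicate symbol.
\<close>

definition goal_sym :: "nat \<Rightarrow> occurrence \<Rightarrow> nat" where
  "goal_sym N x = N + encode (0 :: nat, x)"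

definition body_sym :: "nat \<Rightarrow> occurrence \<Rightarrow> nat" where
  "body_sym N x = N + encode (1 :: nat, x)"

definition search_sym :: "nat \<Rightarrow> ty \<Rightarrow> nat" where
  "search_sym N \<gamma> = N + encode (2 :: nat, \<gamma>)"

definition arg_sym :: "nat \<Rightarrow> ty \<times> ty \<Rightarrow> nat" where
  "arg_sym N p = N + encode (3 :: nat, p)"

definition fun_sym :: "nat \<Rightarrow> ty \<times> ty \<Rightarrow> nat" where
  "fun_sym N p = N + encode (4 :: nat, p)"

lemmas fresh_sym_defs = goal_sym_def body_sym_def search_sym_def arg_sym_def fun_sym_def

definition call :: "nat \<Rightarrow> ty list \<Rightarrow> goal \<Rightarrow> goal" where
  "call N \<Gamma> G = Atom N (apps (Sym (goal_sym N (\<Gamma>, G))) (map Var [0..<length \<Gamma>]))"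

definition goal_clause :: "nat \<Rightarrow> occurrence \<Rightarrow> clause" where
  "goal_clause N = (\<lambda>(\<Gamma>, G). Clause \<Gamma>
     (case G of Atom P s \<Rightarrow> Atom P s
      | Conj H K \<Rightarrow> Conj (call N \<Gamma> H) (call N \<Gamma> K)
      | Exists \<gamma> H \<Rightarrow> Atom N (App (Sym (search_sym N \<gamma>))
          (apps (Sym (body_sym N (\<Gamma>, G))) (map Var [0..<length \<Gamma>])))
      | Tru \<Rightarrow> Tru)
     N (apps (Sym (goal_sym N (\<Gamma>, G))) (map Var [0..<length \<Gamma>])))"

text \<open>
  The search supplies the witness as the last argument, whereas it has index 0 in the body.
  Occurrences other than existential ones get a redundant clause and an unused symbol.
\<close>

definition body_clause :: "nat \<Rightarrow> occurrence \<Rightarrow> clause" where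
  "body_clause N = (\<lambda>(\<Gamma>, G).
     case G of Atom P s \<Rightarrow> goal_clause N (\<Gamma>, G) | Conj H K \<Rightarrow> goal_clause N (\<Gamma>, G)
     | Exists \<gamma> H \<Rightarrow> Clause (\<Gamma> @ [\<gamma>])
         (Atom N (apps (Sym (goal_sym N (\<gamma> # \<Gamma>, H))) (Var (length \<Gamma>) # map Var [0..<length \<Gamma>])))
         N (apps (Sym (body_sym N (\<Gamma>, G))) (map Var [0..<Suc (length \<Gamma>)]))
     | Tru \<Rightarrow> goal_clause N (\<Gamma>, G))"

definition body_type :: "occurrence \<Rightarrow> ty" where
  "body_type = (\<lambda>(\<Gamma>, G). case G of Atom P s \<Rightarrow> Iota | Conj H K \<Rightarrow> Iota
     | Exists \<gamma> H \<Rightarrow> arrows (\<Gamma> @ [\<gamma>]) Iota | Tru \<Rightarrow> Iota)"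

section \<open>Clauses of the search for closed terms\<close>

definition sym_clause :: "nat \<Rightarrow> nat \<times> ty \<Rightarrow> clause" where
  "sym_clause N = (\<lambda>(c, \<gamma>). Clause [Arrow \<gamma> Iota] (Atom N (App (Var 0) (Sym c)))
     N (apps (Sym (search_sym N \<gamma>)) [Var 0]))"

text \<open>Partial applications serve as closures, there being no abstraction:
  \<open>App (Sym (arg_sym N (\<delta>, \<gamma>))) w\<close> is the continuation that remembers
  \<open>w\<close> and awaits an argument of type \<open>\<delta>\<close>.\<close>

definition arg_clause :: "nat \<Rightarrow> ty \<times> ty \<Rightarrow> clause" where
  "arg_clause N = (\<lambda>(\<delta>, \<gamma>). Clause [Arrow \<gamma> Iota]
     (Atom N (App (Sym (search_sym N \<delta>)) (App (Sym (arg_sym N (\<delta>, \<gamma>))) (Var 0))))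
     N (apps (Sym (search_sym N \<gamma>)) [Var 0]))"

text \<open>Variable 1 is the argument just found. \<open>fun_sym\<close> applied to the
  continuation and this argument is the next continuation, which awaits a function.\<close>

definition fun_clause :: "nat \<Rightarrow> ty \<times> ty \<Rightarrow> clause" where
  "fun_clause N = (\<lambda>(\<delta>, \<gamma>). Clause [Arrow \<gamma> Iota, \<delta>]
     (Atom N (App (Sym (search_sym N (Arrow \<delta> \<gamma>)))
       (apps (Sym (fun_sym N (\<delta>, \<gamma>))) [Var 0, Var 1])))
     N (apps (Sym (arg_sym N (\<delta>, \<gamma>))) [Var 0, Var 1]))"

text \<open>The function is found last and so has index 2; the argument, found before it, has index
  1.\<close>

definition app_clause :: "nat \<Rightarrow> ty \<times> ty \<Rightarrow> clause" where
  "app_clause N = (\<lambda>(\<delta>, \<gamma>). Clause [Arrow \<gamma> Iota, \<delta>, Arrow \<delta> \<gamma>]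
     (Atom N (App (Var 0) (App (Var 2) (Var 1))))
     N (apps (Sym (fun_sym N (\<delta>, \<gamma>))) [Var 0, Var 1, Var 2]))"

text \<open>Only the body is delegated to the fresh predicate. The head keeps the original
  predicate, which the goal clauses of atomic occurrences call directly.\<close>

definition program_clause :: "nat \<Rightarrow> clause \<Rightarrow> clause" where
  "program_clause N C = (case C of Clause \<gamma>s G P s \<Rightarrow> Clause \<gamma>s (call N \<gamma>s G) P s)"

text \<open>One number more than in \<open>arrow_types\<close>: the code of
  \<open>Arrow \<delta> \<gamma>\<close> is the successor of the code of
  \<open>(\<delta>, \<gamma>)\<close>, and \<open>fun_clause\<close> starts a search at this arrow
  type.\<close>

definition search_types :: "nat \<Rightarrow> ty list" where
  "search_types N = map (inv encode) [0..<Suc N]"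

definition arrow_types :: "nat \<Rightarrow> (ty \<times> ty) list" where
  "arrow_types N = map (inv encode) [0..<N]"

definition reduced_funs :: "nat \<Rightarrow> occurrence list \<Rightarrow> signature \<Rightarrow> signature" where
  "reduced_funs N xs \<Sigma> = \<Sigma> @
     map (\<lambda>x. (goal_sym N x, arrows (fst x) Iota)) xs @
     map (\<lambda>x. (body_sym N x, body_type x)) xs @
     map (\<lambda>\<gamma>. (search_sym N \<gamma>, Arrow (Arrow \<gamma> Iota) Iota)) (search_types N) @
     map (\<lambda>p. (arg_sym N p, arrows [Arrow (snd p) Iota, fst p] Iota)) (arrow_types N) @
     map (\<lambda>p. (fun_sym N p, arrows [Arrow (snd p) Iota, fst p, Arrow (fst p) (snd p)] Iota)) (arrow_types N)"

definition reduced_defn :: "nat \<Rightarrow> occurrence list \<Rightarrow> signature \<Rightarrow> definite \<Rightarrow> definite" where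
  "reduced_defn N xs \<Sigma> D =
     map (program_clause N) D @ map (goal_clause N) xs @ map (body_clause N) xs @
     map (sym_clause N) \<Sigma> @ map (arg_clause N) (arrow_types N) @
     map (fun_clause N) (arrow_types N) @ map (app_clause N) (arrow_types N)"

definition roots :: "problem \<Rightarrow> occurrence list" where
  "roots I = ([], query I) # map (\<lambda>C. case C of Clause \<gamma>s G P s \<Rightarrow> (\<gamma>s, G)) (defn I)"

text \<open>\<open>Suc (encode I)\<close> has two roles as \<open>N\<close>: it exceeds all names
  declared in \<open>I\<close>, and it exceeds the codes of the symbol types and of the subgoals of
  \<open>I\<close>.\<close>

definition reduce :: "problem \<Rightarrow> problem" where
  "reduce I = Problem
     (reduced_funs (Suc (encode I)) (occurrences (roots I)) (funs I))
     (Suc (encode I) # preds I)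
     (reduced_defn (Suc (encode I)) (occurrences (roots I)) (funs I) (defn I))
     (call (Suc (encode I)) [] (query I))"

section \<open>Enumeration of the types by their codes\<close>

lemma surj_encode_ty: "surj (encode :: ty \<Rightarrow> nat)"
proof -
  have "\<exists>\<gamma> :: ty. encode \<gamma> = n" for n
  proof (induction n rule: less_induct)
    case (less n)
    show ?case
    proof (cases n)
      case 0
      then show ?thesis by (auto intro: exI[of _ Iota])
    next
      case (Suc m)
      obtain a b where m: "m = prod_encode (a, b)" by (metis prod_decode_inverse surj_pair)
      then have "a < n" "b < n"
        using Suc le_prod_encode_1[of a b] le_prod_encode_2[of b a] by auto
      then obtain \<delta> \<gamma> :: ty where "encode \<delta> = a" "encode \<gamma> = b" using less by blast
      then show ?thesis using Suc m by (intro exI[of _ "Arrow \<delta> \<gamma>"]) simp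
    qed
  qed
  then show ?thesis by (metis surjI)
qed

lemma surj_encode_ty_pair: "surj (encode :: ty \<times> ty \<Rightarrow> nat)"
proof (rule surjI)
  fix n
  show "encode (inv (encode :: ty \<Rightarrow> nat) (fst (prod_decode n)), inv (encode :: ty \<Rightarrow> nat) (snd (prod_decode n))) = n"
    by (simp add: surj_f_inv_f[OF surj_encode_ty])
qed

lemma map_inv_encode:
  assumes "surj (encode :: 'a :: encodable \<Rightarrow> nat)"
  shows "set (map (inv encode) [0..<n]) = {x :: 'a. encode x < n}"
    and "distinct (map (inv encode :: nat \<Rightarrow> 'a) [0..<n])"
proof -
  have "inj (encode :: 'a \<Rightarrow> nat)" by (simp add: inj_def)
  then show "set (map (inv encode) [0..<n]) = {x :: 'a. encode x < n}"
    using assms by (force simp: surj_f_inv_f inv_f_f image_iff)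
  show "distinct (map (inv encode :: nat \<Rightarrow> 'a) [0..<n])"
    using surj_imp_inj_inv[OF assms] by (auto simp: distinct_map intro: inj_on_subset)
qed

lemma set_search_types: "set (search_types N) = {\<gamma>. encode \<gamma> \<le> N}"
  unfolding search_types_def map_inv_encode[OF surj_encode_ty] by auto

lemma set_arrow_types: "set (arrow_types N) = {p. encode p < N}"
  unfolding arrow_types_def map_inv_encode[OF surj_encode_ty_pair] by auto

lemma effective_reduce: "effective reduce"
  unfolding reduce_def reduced_funs_def reduced_defn_def roots_def program_clause_def app_clause_def
    fun_clause_def arg_clause_def sym_clause_def body_type_def body_clause_def goal_clause_def call_def
    search_types_def arrow_types_def fresh_sym_defs
  by (intro effective_intros effective_inv_encode surj_encode_ty surj_encode_ty_pair)

text \<open>Correctness is separated from the computation of the data: from here on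
  \<open>xs\<close> is any duplicate-free list of well-formed occurrences that contains the clause
  bodies and is closed under \<open>children\<close>, and \<open>N\<close> is any sufficiently large
  number.\<close>

locale reduction =
  fixes \<Sigma> :: signature and \<Pi> :: "nat list" and D :: definite and N :: nat and xs :: "occurrence list"
  assumes distinct_\<Sigma>: "distinct (map fst \<Sigma>)"
    and \<Sigma>_bound: "(c, \<gamma>) \<in> set \<Sigma> \<Longrightarrow> c < N \<and> encode \<gamma> < N"
    and \<Pi>_bound: "P \<in> set \<Pi> \<Longrightarrow> P < N"
    and wf_D: "C \<in> set D \<Longrightarrow> wf_clause \<Sigma> \<Pi> C"
    and distinct_xs: "distinct xs"
    and D_xs: "Clause \<gamma>s G P s \<in> set D \<Longrightarrow> (\<gamma>s, G) \<in> set xs"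
    and children_xs: "x \<in> set xs \<Longrightarrow> set (children x) \<subseteq> set xs"
    and wf_xs: "(\<Gamma>, G) \<in> set xs \<Longrightarrow> wf_goal \<Sigma> \<Pi> \<Gamma> G"
    and bound_xs: "(\<Gamma>, G) \<in> set xs \<Longrightarrow> encode G < N"
begin

abbreviation "\<Sigma>' \<equiv> reduced_funs N xs \<Sigma>"
abbreviation "D' \<equiv> reduced_defn N xs \<Sigma> D"

lemma \<Sigma>_subset: "set \<Sigma> \<subseteq> set \<Sigma>'"
  by (auto simp: reduced_funs_def)

lemma children_xs_simps:
  "(\<Gamma>, Conj H K) \<in> set xs \<Longrightarrow> (\<Gamma>, H) \<in> set xs"
  "(\<Gamma>, Conj H K) \<in> set xs \<Longrightarrow> (\<Gamma>, K) \<in> set xs"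
  "(\<Gamma>, Exists \<gamma> H) \<in> set xs \<Longrightarrow> (\<gamma> # \<Gamma>, H) \<in> set xs"
  using children_xs by (force simp: children_def)+

lemma exists_type_bound:
  assumes "(\<Gamma>, Exists \<gamma> H) \<in> set xs"
  shows "encode \<gamma> < N"
  using bound_xs[OF assms] le_prod_encode_1[of "encode \<gamma>" "encode H"]
    le_prod_encode_2[of "prod_encode (encode \<gamma>, encode H)" 2] by simp

lemma arrow_type_bound:
  assumes "(\<delta>, \<gamma>) \<in> set (arrow_types N)"
  shows "encode \<delta> < N" "encode \<gamma> < N" "encode (Arrow \<delta> \<gamma>) \<le> N"
  using assms le_prod_encode_1[of "encode \<delta>" "encode \<gamma>"] le_prod_encode_2[of "encode \<gamma>" "encode \<delta>"]
  by (auto simp: set_arrow_types)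

text \<open>Application passes to the right part of an arrow type, whose code is smaller, so the
  bound for symbol types extends to all closed terms. Hence the finitely many search types
  suffice.\<close>

lemma closed_type_bound: "closed_term \<Sigma> t \<gamma> \<Longrightarrow> encode \<gamma> < N"
proof (induction t \<gamma> rule: has_type.induct)
  case (3 s \<gamma> \<delta> t)
  then show ?case using le_prod_encode_2[of "encode \<delta>" "encode \<gamma>"] by simp
qed (auto dest: \<Sigma>_bound)

lemma fresh_typed:
  shows "(\<Gamma>, G) \<in> set xs \<Longrightarrow> (goal_sym N (\<Gamma>, G), arrows \<Gamma> Iota) \<in> set \<Sigma>'"
    and "(\<Gamma>, Exists \<gamma> H) \<in> set xs \<Longrightarrow> (body_sym N (\<Gamma>, Exists \<gamma> H), arrows (\<Gamma> @ [\<gamma>]) Iota) \<in> set \<Sigma>'"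
    and "encode \<gamma> \<le> N \<Longrightarrow> (search_sym N \<gamma>, arrows [Arrow \<gamma> Iota] Iota) \<in> set \<Sigma>'"
    and "(\<delta>, \<gamma>) \<in> set (arrow_types N) \<Longrightarrow>
      (arg_sym N (\<delta>, \<gamma>), arrows [Arrow \<gamma> Iota, \<delta>] Iota) \<in> set \<Sigma>'"
    and "(\<delta>, \<gamma>) \<in> set (arrow_types N) \<Longrightarrow>
      (fun_sym N (\<delta>, \<gamma>), arrows [Arrow \<gamma> Iota, \<delta>, Arrow \<delta> \<gamma>] Iota) \<in> set \<Sigma>'"
  unfolding reduced_funs_def set_append set_map set_search_types
  by (force simp: body_type_def)+

text \<open>The five families of fresh symbols carry distinct tags in their codes, each family is
  injective, and all of their numbers are at least \<open>N\<close>, hence above the names in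
  \<open>\<Sigma>\<close>.\<close>

lemma distinct_\<Sigma>': "distinct (map fst \<Sigma>')"
proof -
  have inj: "inj_on (goal_sym N) A" "inj_on (body_sym N) A" "inj_on (search_sym N) B"
      "inj_on (arg_sym N) C" "inj_on (fun_sym N) C" for A B C
    by (auto simp: inj_on_def fresh_sym_defs)
  have "(N + n, \<gamma>) \<notin> set \<Sigma>" for n \<gamma>
    using \<Sigma>_bound[of "N + n" \<gamma>] by auto
  then show ?thesis
    using distinct_\<Sigma> distinct_xs map_inv_encode(2)[OF surj_encode_ty, of "Suc N"]
      map_inv_encode(2)[OF surj_encode_ty_pair, of N]
    by (auto simp: reduced_funs_def search_types_def[symmetric] arrow_types_def[symmetric] comp_def
        distinct_map inj simp del: upt_Suc) (auto simp: fresh_sym_defs)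
qed

section \<open>Well-formedness and absence of existential quantifiers\<close>

lemma wf_call: "(\<Gamma>, G) \<in> set xs \<Longrightarrow> wf_goal \<Sigma>' (N # \<Pi>) \<Gamma> (call N \<Gamma> G)"
  using has_type_vars[of \<Sigma>' \<Gamma> "[]"] fresh_typed(1)[of \<Gamma> G]
  by (auto simp: call_def intro!: has_type_apps intro: has_type.intros)

lemma wf_goal_clause:
  assumes "x \<in> set xs"
  shows "wf_clause \<Sigma>' (N # \<Pi>) (goal_clause N x)"
proof -
  obtain \<Gamma> G where x: "x = (\<Gamma>, G)" by (cases x)
  have head: "\<exists>c. (c, arrows \<Gamma> Iota) \<in> set \<Sigma>' \<and>
      apps (Sym (goal_sym N (\<Gamma>, G))) (map Var [0..<length \<Gamma>]) = apps (Sym c) (map Var [0..<length \<Gamma>])"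
    using fresh_typed(1) assms x by blast
  show ?thesis
  proof (cases G)
    case (Atom P s)
    then show ?thesis using wf_xs[of \<Gamma> G] assms head x
      by (auto simp: goal_clause_def intro: has_type_mono[OF _ \<Sigma>_subset])
  next
    case (Conj H K)
    then show ?thesis
      using wf_call assms head x children_xs_simps(1,2)[of \<Gamma> H K] by (auto simp: goal_clause_def)
  next
    case (Exists \<gamma> H)
    have "has_type \<Sigma>' \<Gamma> (apps (Sym (body_sym N (\<Gamma>, G))) (map Var [0..<length \<Gamma>])) (Arrow \<gamma> Iota)"
      using fresh_typed(2)[of \<Gamma> \<gamma> H] has_type_vars[of \<Sigma>' \<Gamma> "[]"] assms x Exists
      by (auto simp: arrows_def intro!: has_type_apps intro: has_type.intros)
    moreover have "has_type \<Sigma>' \<Gamma> (Sym (search_sym N \<gamma>)) (Arrow (Arrow \<gamma> Iota) Iota)"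
      using fresh_typed(3)[of \<gamma>] exists_type_bound[of \<Gamma> \<gamma> H] assms x Exists by (auto intro: has_type.intros)
    ultimately show ?thesis using head Exists x
      by (auto simp: goal_clause_def intro: has_type.intros)
  next
    case Tru
    then show ?thesis using head x by (auto simp: goal_clause_def)
  qed
qed

lemma wf_body_clause:
  assumes "x \<in> set xs"
  shows "wf_clause \<Sigma>' (N # \<Pi>) (body_clause N x)"
proof (cases "\<exists>\<Gamma> \<gamma> H. x = (\<Gamma>, Exists \<gamma> H)")
  case True
  then obtain \<Gamma> \<gamma> H where x: "x = (\<Gamma>, Exists \<gamma> H)" by blast
  have "has_type \<Sigma>' (\<Gamma> @ [\<gamma>])
      (apps (Sym (goal_sym N (\<gamma> # \<Gamma>, H))) (Var (length \<Gamma>) # map Var [0..<length \<Gamma>])) Iota"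
  proof (rule has_type_apps)
    show "has_type \<Sigma>' (\<Gamma> @ [\<gamma>]) (Sym (goal_sym N (\<gamma> # \<Gamma>, H))) (arrows (\<gamma> # \<Gamma>) Iota)"
      using fresh_typed(1) children_xs_simps(3) assms x by (blast intro: has_type.intros)
    show "list_all2 (has_type \<Sigma>' (\<Gamma> @ [\<gamma>])) (Var (length \<Gamma>) # map Var [0..<length \<Gamma>]) (\<gamma> # \<Gamma>)"
      using has_type_vars by (auto intro: has_type_Var)
  qed
  moreover have "(body_sym N x, arrows (\<Gamma> @ [\<gamma>]) Iota) \<in> set \<Sigma>'"
    using fresh_typed(2) assms x by blast
  ultimately show ?thesis
    unfolding x by (auto simp: body_clause_def simp del: upt_Suc apps_append apps_Sym_eq_iff)
next
  case False
  then have "body_clause N x = goal_clause N x"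
    by (cases x) (auto simp: body_clause_def split: goal.split)
  then show ?thesis using wf_goal_clause[OF assms] by simp
qed

lemma wf_program_clause:
  assumes "C \<in> set D"
  shows "wf_clause \<Sigma>' (N # \<Pi>) (program_clause N C)"
proof (cases C)
  case (Clause \<gamma>s G P s)
  then show ?thesis
    using wf_D[OF assms] wf_call[of \<gamma>s G] D_xs[of \<gamma>s G P s] assms \<Sigma>_subset by (auto simp: program_clause_def)
qed

lemma wf_search_clauses:
  shows "p \<in> set \<Sigma> \<Longrightarrow> wf_clause \<Sigma>' (N # \<Pi>) (sym_clause N p)"
    and "q \<in> set (arrow_types N) \<Longrightarrow> wf_clause \<Sigma>' (N # \<Pi>) (arg_clause N q)"
    and "q \<in> set (arrow_types N) \<Longrightarrow> wf_clause \<Sigma>' (N # \<Pi>) (fun_clause N q)"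
    and "q \<in> set (arrow_types N) \<Longrightarrow> wf_clause \<Sigma>' (N # \<Pi>) (app_clause N q)"
proof -
  obtain c \<gamma> where p: "p = (c, \<gamma>)" by (cases p)
  obtain \<delta> \<epsilon> where q: "q = (\<delta>, \<epsilon>)" by (cases q)
  note Vars = has_type_Var[of 0] has_type_Var[of "Suc 0"] has_type_Var[of 2]
  show "wf_clause \<Sigma>' (N # \<Pi>) (sym_clause N p)" if "p \<in> set \<Sigma>"
  proof -
    have "(c, \<gamma>) \<in> set \<Sigma>'" using that p \<Sigma>_subset by auto
    moreover have "encode \<gamma> \<le> N" using that p \<Sigma>_bound[of c \<gamma>] by simp
    ultimately show ?thesis using fresh_typed(3)[of \<gamma>]
      by (auto simp: p sym_clause_def intro!: exI[of _ "search_sym N \<gamma>"] has_type.intros(3)[where \<gamma> = \<gamma>] Vars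
          intro: has_type.intros(2))
  qed
  assume "q \<in> set (arrow_types N)"
  then have q': "(\<delta>, \<epsilon>) \<in> set (arrow_types N)" using q by simp
  note bound = arrow_type_bound[OF q']
  have search: "has_type \<Sigma>' \<Gamma> (Sym (search_sym N \<gamma>)) (Arrow (Arrow \<gamma> Iota) Iota)"
    if "encode \<gamma> \<le> N" for \<Gamma> \<gamma>
    using fresh_typed(3)[OF that] by (auto intro: has_type.intros(2))
  have arg: "has_type \<Sigma>' \<Gamma> (Sym (arg_sym N (\<delta>, \<epsilon>))) (Arrow (Arrow \<epsilon> Iota) (Arrow \<delta> Iota))" for \<Gamma>
    using fresh_typed(4)[OF q'] by (auto intro: has_type.intros(2))
  have "fun": "has_type \<Sigma>' \<Gamma> (Sym (fun_sym N (\<delta>, \<epsilon>)))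
      (Arrow (Arrow \<epsilon> Iota) (Arrow \<delta> (Arrow (Arrow \<delta> \<epsilon>) Iota)))" for \<Gamma>
    using fresh_typed(5)[OF q'] by (auto intro: has_type.intros(2))
  show "wf_clause \<Sigma>' (N # \<Pi>) (arg_clause N q)"
    using fresh_typed(3)[of \<epsilon>] bound
    by (auto simp: q arg_clause_def intro!: exI[of _ "search_sym N \<epsilon>"]
        has_type.intros(3)[OF search] has_type.intros(3)[OF arg] Vars)
  show "wf_clause \<Sigma>' (N # \<Pi>) (fun_clause N q)"
    using fresh_typed(4)[OF q'] bound
    by (auto simp: q fun_clause_def intro!: exI[of _ "arg_sym N (\<delta>, \<epsilon>)"]
        has_type.intros(3)[OF search] has_type.intros(3)[OF has_type.intros(3)[OF "fun"]] Vars)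
  have "has_type \<Sigma>' [Arrow \<epsilon> Iota, \<delta>, Arrow \<delta> \<epsilon>] (App (Var 0) (App (Var 2) (Var 1))) Iota"
    by (rule has_type.intros(3)[where \<gamma> = \<epsilon>], simp add: Vars, rule has_type.intros(3)[where \<gamma> = \<delta>])
      (simp_all add: Vars)
  then show "wf_clause \<Sigma>' (N # \<Pi>) (app_clause N q)"
    using fresh_typed(5)[OF q'] by (auto simp: q app_clause_def intro!: exI[of _ "fun_sym N (\<delta>, \<epsilon>)"])
qed

lemma wf_reduced_defn: "C \<in> set D' \<Longrightarrow> wf_clause \<Sigma>' (N # \<Pi>) C"
  unfolding reduced_defn_def
  using wf_program_clause wf_goal_clause wf_body_clause wf_search_clauses by auto

lemma ex_free_reduced_defn: "C \<in> set D' \<Longrightarrow> ex_free_clause C"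
  by (auto simp: reduced_defn_def program_clause_def call_def goal_clause_def body_clause_def
      sym_clause_def arg_clause_def fun_clause_def app_clause_def split: goal.splits clause.splits)


section \<open>Completeness of the reduction\<close>

lemma reduced_defn_mem:
  "C \<in> set D \<Longrightarrow> program_clause N C \<in> set D'"
  "x \<in> set xs \<Longrightarrow> goal_clause N x \<in> set D'"
  "x \<in> set xs \<Longrightarrow> body_clause N x \<in> set D'"
  "q \<in> set \<Sigma> \<Longrightarrow> sym_clause N q \<in> set D'"
  "p \<in> set (arrow_types N) \<Longrightarrow> arg_clause N p \<in> set D'"
  "p \<in> set (arrow_types N) \<Longrightarrow> fun_clause N p \<in> set D'"
  "p \<in> set (arrow_types N) \<Longrightarrow> app_clause N p \<in> set D'"
  by (simp_all add: reduced_defn_def)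

lemma provable_clause:
  assumes "Clause \<gamma>s B P s \<in> set D'" "list_all2 (closed_term \<Sigma>') ts \<gamma>s"
    and "provable \<Sigma>' D' (subst_goal (inst ts) B)" "subst (inst ts) s = t"
  shows "provable \<Sigma>' D' (Atom P t)"
  using provable.intros(4)[OF assms(1-3)] assms(4) by simp

lemma subst_call:
  "length ts = length \<Gamma> \<Longrightarrow> subst_goal (inst ts) (call N \<Gamma> G) = Atom N (apps (Sym (goal_sym N (\<Gamma>, G))) ts)"
  using map_inst_vars[of ts "length \<Gamma>" "[]"] by (simp add: call_def comp_def)

text \<open>The witness is over \<open>\<Sigma>\<close>, but the continuation ranges over closed
  terms over \<open>\<Sigma>'\<close>: for an application the induction hypotheses are used at
  continuations built from \<open>arg_sym\<close> and \<open>fun_sym\<close>.\<close>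

lemma search_complete:
  assumes "closed_term \<Sigma> t \<gamma>" "closed_term \<Sigma>' w (Arrow \<gamma> Iota)" "provable \<Sigma>' D' (Atom N (App w t))"
  shows "provable \<Sigma>' D' (Atom N (App (Sym (search_sym N \<gamma>)) w))"
  using assms
proof (induction t \<gamma> arbitrary: w rule: has_type.induct)
  case (1 i)
  then show ?case by simp
next
  case (2 c \<gamma>)
  show ?case
  proof (rule provable_clause)
    show "Clause [Arrow \<gamma> Iota] (Atom N (App (Var 0) (Sym c))) N (apps (Sym (search_sym N \<gamma>)) [Var 0]) \<in> set D'"
      using reduced_defn_mem(4)[OF 2(1)] by (simp add: sym_clause_def)
    show "list_all2 (closed_term \<Sigma>') [w] [Arrow \<gamma> Iota]" using 2 by simp
  qed (use 2 in auto)
next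
  case (3 s \<delta> \<gamma> t)
  let ?arg = "App (Sym (arg_sym N (\<delta>, \<gamma>))) w"
  let ?fun = "apps (Sym (fun_sym N (\<delta>, \<gamma>))) [w, t]"
  have p: "(\<delta>, \<gamma>) \<in> set (arrow_types N)"
    using closed_type_bound[OF 3(1)] by (simp add: set_arrow_types)
  have st: "closed_term \<Sigma>' s (Arrow \<delta> \<gamma>)" "closed_term \<Sigma>' t \<delta>"
    using 3(1,2) has_type_mono \<Sigma>_subset by blast+
  \<comment> \<open>The derivation is assembled from the end of the search: first the final
    application, then the search for the function \<open>s\<close>, then the search for the argument
    \<open>t\<close>.\<close>
  have "provable \<Sigma>' D' (Atom N (App ?fun s))"
  proof (rule provable_clause)
    show "Clause [Arrow \<gamma> Iota, \<delta>, Arrow \<delta> \<gamma>] (Atom N (App (Var 0) (App (Var 2) (Var 1))))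
        N (apps (Sym (fun_sym N (\<delta>, \<gamma>))) [Var 0, Var 1, Var 2]) \<in> set D'"
      using reduced_defn_mem(7)[OF p] by (simp add: app_clause_def)
    show "list_all2 (closed_term \<Sigma>') [w, t, s] [Arrow \<gamma> Iota, \<delta>, Arrow \<delta> \<gamma>]" using 3 st by simp
  qed (use 3 in \<open>auto simp: numeral_2_eq_2\<close>)
  moreover have "closed_term \<Sigma>' ?fun (Arrow (Arrow \<delta> \<gamma>) Iota)"
    using fresh_typed(5)[OF p] 3 st
    by (intro has_type_apps[where \<gamma>s = "[Arrow \<gamma> Iota, \<delta>]"]) (auto intro: has_type.intros)
  ultimately have "provable \<Sigma>' D' (Atom N (App (Sym (search_sym N (Arrow \<delta> \<gamma>))) ?fun))"
    by (intro 3)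
  then have "provable \<Sigma>' D' (Atom N (App ?arg t))"
  proof (intro provable_clause)
    show "Clause [Arrow \<gamma> Iota, \<delta>] (Atom N (App (Sym (search_sym N (Arrow \<delta> \<gamma>)))
          (apps (Sym (fun_sym N (\<delta>, \<gamma>))) [Var 0, Var 1])))
        N (apps (Sym (arg_sym N (\<delta>, \<gamma>))) [Var 0, Var 1]) \<in> set D'"
      using reduced_defn_mem(6)[OF p] by (simp add: fun_clause_def)
    show "list_all2 (closed_term \<Sigma>') [w, t] [Arrow \<gamma> Iota, \<delta>]" using 3 st by simp
  qed auto
  moreover have "closed_term \<Sigma>' ?arg (Arrow \<delta> Iota)"
    using fresh_typed(4)[OF p] 3 by (auto intro: has_type.intros)
  ultimately have "provable \<Sigma>' D' (Atom N (App (Sym (search_sym N \<delta>)) ?arg))"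
    by (intro 3)
  then show ?case
  proof (intro provable_clause)
    show "Clause [Arrow \<gamma> Iota] (Atom N (App (Sym (search_sym N \<delta>)) (App (Sym (arg_sym N (\<delta>, \<gamma>))) (Var 0))))
        N (apps (Sym (search_sym N \<gamma>)) [Var 0]) \<in> set D'"
      using reduced_defn_mem(5)[OF p] by (simp add: arg_clause_def)
    show "list_all2 (closed_term \<Sigma>') [w] [Arrow \<gamma> Iota]" using 3 by simp
  qed auto
qed

lemma provable_goal_sym:
  assumes "(\<Gamma>, H) \<in> set xs" "list_all2 (closed_term \<Sigma>) ts \<Gamma>"
    and "goal_clause N (\<Gamma>, H) = Clause \<Gamma> B N (apps (Sym (goal_sym N (\<Gamma>, H))) (map Var [0..<length \<Gamma>]))"
    and "provable \<Sigma>' D' (subst_goal (inst ts) B)"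
  shows "provable \<Sigma>' D' (Atom N (apps (Sym (goal_sym N (\<Gamma>, H))) ts))"
proof (rule provable_clause)
  show "Clause \<Gamma> B N (apps (Sym (goal_sym N (\<Gamma>, H))) (map Var [0..<length \<Gamma>])) \<in> set D'"
    using reduced_defn_mem(2)[OF assms(1)] assms(3) by simp
  show "subst (inst ts) (apps (Sym (goal_sym N (\<Gamma>, H))) (map Var [0..<length \<Gamma>])) = apps (Sym (goal_sym N (\<Gamma>, H))) ts"
    using list_all2_lengthD[OF assms(2)] map_inst_vars[of ts _ "[]"] by (simp add: comp_def)
qed (use assms list_all2_closed_mono \<Sigma>_subset in auto)

text \<open>A goal may be an instance of several occurrences, so the first part quantifies over all
  of them. The parts depend on each other: the goal clause of an atomic occurrence calls the
  original atom, and deriving that atom by a program clause uses the first part for the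
  body.\<close>

lemma complete:
  assumes "provable \<Sigma> D X"
  shows "(\<forall>\<Gamma> H ts. (\<Gamma>, H) \<in> set xs \<longrightarrow> list_all2 (closed_term \<Sigma>) ts \<Gamma> \<longrightarrow> X = subst_goal (inst ts) H \<longrightarrow>
      provable \<Sigma>' D' (Atom N (apps (Sym (goal_sym N (\<Gamma>, H))) ts))) \<and>
    (\<forall>P s. X = Atom P s \<longrightarrow> provable \<Sigma>' D' (Atom P s))"
  using assms
proof (induction rule: provable.induct)
  case 1
  have "provable \<Sigma>' D' (Atom N (apps (Sym (goal_sym N (\<Gamma>, H))) ts))"
    if "(\<Gamma>, H) \<in> set xs" "list_all2 (closed_term \<Sigma>) ts \<Gamma>" "Tru = subst_goal (inst ts) H" for \<Gamma> H ts
    using that by (cases H) (auto simp: goal_clause_def intro!: provable_goal_sym provable.intros(1))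
  then show ?case by blast
next
  case (2 G K)
  have "provable \<Sigma>' D' (Atom N (apps (Sym (goal_sym N (\<Gamma>, H))) ts))"
    if xs: "(\<Gamma>, H) \<in> set xs" and ts: "list_all2 (closed_term \<Sigma>) ts \<Gamma>"
      and eq: "Conj G K = subst_goal (inst ts) H" for \<Gamma> H ts
  proof -
    obtain G' K' where H: "H = Conj G' K'" "G = subst_goal (inst ts) G'" "K = subst_goal (inst ts) K'"
      using eq by (cases H) auto
    then have "provable \<Sigma>' D' (subst_goal (inst ts) (Conj (call N \<Gamma> G') (call N \<Gamma> K')))"
      using 2 ts xs children_xs_simps(1,2)[of \<Gamma> G' K'] list_all2_lengthD[OF ts]
      by (auto simp: subst_call intro!: provable.intros(2))
    then show ?thesis
      by (intro provable_goal_sym[OF xs ts]) (auto simp: goal_clause_def H)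
  qed
  then show ?case by blast
next
  case (3 t \<gamma> G)
  have "provable \<Sigma>' D' (Atom N (apps (Sym (goal_sym N (\<Gamma>, H))) ts))"
    if xs: "(\<Gamma>, H) \<in> set xs" and ts: "list_all2 (closed_term \<Sigma>) ts \<Gamma>"
      and eq: "Exists \<gamma> G = subst_goal (inst ts) H" for \<Gamma> H ts
  proof -
    obtain G' where H: "H = Exists \<gamma> G'" "G = subst_goal (lift (inst ts)) G'"
      using eq by (cases H) auto
    note len = list_all2_lengthD[OF ts]
    have xs': "(\<Gamma>, Exists \<gamma> G') \<in> set xs" using xs H by simp
    have ts': "list_all2 (closed_term \<Sigma>') ts \<Gamma>" "closed_term \<Sigma>' t \<gamma>"
      using list_all2_closed_mono[OF ts \<Sigma>_subset] has_type_mono[OF 3(1) \<Sigma>_subset] by auto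
    have vars: "map (\<lambda>i. inst (ts @ [t]) i) [0..<length \<Gamma>] = ts" "inst (ts @ [t]) (length \<Gamma>) = t"
      using map_inst_vars[of ts "length \<Gamma>" "[t]"] len nth_append_length[of ts t] by (simp_all add: inst_def)
    let ?w = "apps (Sym (body_sym N (\<Gamma>, H))) ts"
    \<comment> \<open>The derivation with \<open>t\<close> put for the bound variable is one for the
      child occurrence, instantiated by \<open>t # ts\<close>.\<close>
    have "provable \<Sigma>' D' (Atom N (apps (Sym (goal_sym N (\<gamma> # \<Gamma>, G'))) (t # ts)))"
      using 3 ts children_xs_simps(3)[OF xs'] by (auto simp: H subst_goal_inst_lift simp del: apps_simps)
    then have "provable \<Sigma>' D' (Atom N (App ?w t))"
    proof (intro provable_clause)
      show "Clause (\<Gamma> @ [\<gamma>])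
         (Atom N (apps (Sym (goal_sym N (\<gamma> # \<Gamma>, G'))) (Var (length \<Gamma>) # map Var [0..<length \<Gamma>])))
         N (apps (Sym (body_sym N (\<Gamma>, H))) (map Var [0..<Suc (length \<Gamma>)])) \<in> set D'"
        using reduced_defn_mem(3)[OF xs'] by (simp add: body_clause_def H)
      show "list_all2 (closed_term \<Sigma>') (ts @ [t]) (\<Gamma> @ [\<gamma>])" using ts' by (intro list_all2_appendI) auto
    qed (auto simp: vars comp_def)
    moreover have "closed_term \<Sigma>' ?w (Arrow \<gamma> Iota)"
      using fresh_typed(2)[OF xs'] ts'
      by (intro has_type_apps[where \<gamma>s = \<Gamma>]) (auto simp: H arrows_def intro: has_type.intros)
    ultimately have "provable \<Sigma>' D' (Atom N (App (Sym (search_sym N \<gamma>)) ?w))"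
      by (intro search_complete[OF 3(1)])
    then show ?thesis
      using map_inst_vars[of ts "length \<Gamma>" "[]"] len
      by (intro provable_goal_sym[OF xs ts]) (auto simp: goal_clause_def H comp_def)
  qed
  then show ?case by blast
next
  case (4 \<gamma>s G P s ts)
  have "provable \<Sigma>' D' (Atom N (apps (Sym (goal_sym N (\<gamma>s, G))) ts))"
    using 4 D_xs by blast
  then have P: "provable \<Sigma>' D' (Atom P (subst (inst ts) s))"
  proof (intro provable_clause)
    show "Clause \<gamma>s (call N \<gamma>s G) P s \<in> set D'"
      using reduced_defn_mem(1)[OF 4(1)] by (simp add: program_clause_def)
  qed (use list_all2_closed_mono[OF 4(2) \<Sigma>_subset] list_all2_lengthD[OF 4(2)] in \<open>simp_all add: subst_call\<close>)
  \<comment> \<open>The atom just derived may be an instance of an atomic occurrence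
    \<open>H\<close> under another substitution \<open>us\<close>.\<close>
  have "provable \<Sigma>' D' (Atom N (apps (Sym (goal_sym N (\<Gamma>, H))) us))"
    if xs: "(\<Gamma>, H) \<in> set xs" and us: "list_all2 (closed_term \<Sigma>) us \<Gamma>"
      and eq: "Atom P (subst (inst ts) s) = subst_goal (inst us) H" for \<Gamma> H us
  proof -
    obtain s' where "H = Atom P s'" "subst (inst ts) s = subst (inst us) s'"
      using eq by (cases H) auto
    then show ?thesis
      using P by (intro provable_goal_sym[OF xs us]) (auto simp: goal_clause_def)
  qed
  then show ?case using P by simp
qed

section \<open>Soundness of the reduction\<close>

text \<open>
  The meaning of the atoms of the fresh predicate: a continuation may be any term, only the witnesses
  found by the search must be closed terms over \<open>\<Sigma>\<close>.
\<close>

inductive sem :: "tm \<Rightarrow> bool" where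
  sem_goal: "(list_all2 (closed_term \<Sigma>) ts \<Gamma> \<Longrightarrow> provable \<Sigma> D (subst_goal (inst ts) G)) \<Longrightarrow>
    sem (apps (Sym (goal_sym N (\<Gamma>, G))) ts)"
| sem_body: "(list_all2 (closed_term \<Sigma>) (t # ts) (\<gamma> # \<Gamma>) \<Longrightarrow> provable \<Sigma> D (subst_goal (inst (t # ts)) G)) \<Longrightarrow>
    sem (apps (Sym (body_sym N (\<Gamma>, Exists \<gamma> G))) (ts @ [t]))"
| sem_search: "closed_term \<Sigma> t \<gamma> \<Longrightarrow> sem (App w t) \<Longrightarrow> sem (apps (Sym (search_sym N \<gamma>)) [w])"
| sem_arg: "closed_term \<Sigma> s (Arrow \<delta> \<gamma>) \<Longrightarrow> sem (App w (App s t)) \<Longrightarrow>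
    sem (apps (Sym (arg_sym N (\<delta>, \<gamma>))) [w, t])"
| sem_fun: "sem (App w (App s t)) \<Longrightarrow> sem (apps (Sym (fun_sym N p)) [w, t, s])"

text \<open>Inversion works because the head symbol determines the rule: tags separate the families,
  and within a family the codes are injective. \<open>apps\<close> stays folded so that spines are
  compared by \<open>apps_Sym_eq_iff\<close>.\<close>

lemma sem_goalD:
  "sem (apps (Sym (goal_sym N (\<Gamma>, G))) ts) \<Longrightarrow> list_all2 (closed_term \<Sigma>) ts \<Gamma> \<Longrightarrow>
    provable \<Sigma> D (subst_goal (inst ts) G)"
  by (cases rule: sem.cases)
    (auto simp: fresh_sym_defs simp del: apps_simps apps_append)

lemma sem_bodyD:
  "sem (apps (Sym (body_sym N (\<Gamma>, Exists \<gamma> G))) (ts @ [t])) \<Longrightarrow> list_all2 (closed_term \<Sigma>) (t # ts) (\<gamma> # \<Gamma>) \<Longrightarrow>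
    provable \<Sigma> D (subst_goal (inst (t # ts)) G)"
  by (cases rule: sem.cases)
    (auto simp: fresh_sym_defs simp del: apps_simps apps_append)

lemma sem_searchE:
  assumes "sem (apps (Sym (search_sym N \<gamma>)) [w])"
  obtains t where "closed_term \<Sigma> t \<gamma>" "sem (App w t)"
  using assms by (cases rule: sem.cases)
    (auto simp: fresh_sym_defs simp del: apps_simps apps_append)

lemma sem_argE:
  assumes "sem (apps (Sym (arg_sym N (\<delta>, \<gamma>))) [w, t])"
  obtains s where "closed_term \<Sigma> s (Arrow \<delta> \<gamma>)" "sem (App w (App s t))"
  using assms by (cases rule: sem.cases)
    (auto simp: fresh_sym_defs simp del: apps_simps apps_append)

lemma sem_funD: "sem (apps (Sym (fun_sym N p)) [w, t, s]) \<Longrightarrow> sem (App w (App s t))"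
  by (cases rule: sem.cases)
    (auto simp: fresh_sym_defs simp del: apps_simps apps_append)

text \<open>For original predicates the claim is restricted to terms closed over
  \<open>\<Sigma>\<close>, because derivations over \<open>\<Sigma>'\<close> can also reach terms
  with fresh symbols. The value \<open>True\<close> at \<open>Exists\<close> settles the existential
  rule at once.\<close>

fun holds :: "goal \<Rightarrow> bool" where
  "holds (Atom P s) \<longleftrightarrow>
    (P \<in> set \<Pi> \<longrightarrow> closed_term \<Sigma> s Iota \<longrightarrow> provable \<Sigma> D (Atom P s)) \<and> (P = N \<longrightarrow> sem s)"
| "holds (Conj G H) \<longleftrightarrow> holds G \<and> holds H"
| "holds (Exists \<gamma> G) \<longleftrightarrow> True"
| "holds Tru \<longleftrightarrow> True"

lemma N_notin_\<Pi>: "N \<notin> set \<Pi>"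
  using \<Pi>_bound by blast

lemma holds_call:
  "length ts = length \<Gamma> \<Longrightarrow>
    holds (subst_goal (inst ts) (call N \<Gamma> G)) \<longleftrightarrow> sem (apps (Sym (goal_sym N (\<Gamma>, G))) ts)"
  by (simp add: subst_call N_notin_\<Pi>)

text \<open>Only the number of substituted terms is prescribed. Where types over
  \<open>\<Sigma>\<close> matter, they are recovered from the head or assumed inside
  \<open>sem\<close>.\<close>

definition preserves_holds :: "clause \<Rightarrow> bool" where
  "preserves_holds C \<longleftrightarrow> (case C of Clause \<gamma>s B P s \<Rightarrow> \<forall>ts. length ts = length \<gamma>s \<longrightarrow>
     holds (subst_goal (inst ts) B) \<longrightarrow> holds (Atom P (subst (inst ts) s)))"

lemma preserves_holdsI:
  "(\<And>ts. length ts = length \<gamma>s \<Longrightarrow> holds (subst_goal (inst ts) B) \<Longrightarrow> holds (Atom P (subst (inst ts) s))) \<Longrightarrow>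
    preserves_holds (Clause \<gamma>s B P s)"
  by (simp add: preserves_holds_def)

text \<open>The instance may use fresh symbols, but the claim concerns only heads closed over
  \<open>\<Sigma>\<close>. Such a head contains all substituted terms, which are therefore closed
  over \<open>\<Sigma>\<close> as well, so that the original clause applies.\<close>

lemma preserves_program_clause:
  assumes "C \<in> set D"
  shows "preserves_holds (program_clause N C)"
proof -
  obtain \<gamma>s G P s where C: "C = Clause \<gamma>s G P s" by (cases C)
  have wf: "wf_clause \<Sigma> \<Pi> (Clause \<gamma>s G P s)" using wf_D assms C by blast
  have "preserves_holds (Clause \<gamma>s (call N \<gamma>s G) P s)"
  proof (rule preserves_holdsI)
    fix ts assume len: "length ts = length \<gamma>s" and body: "holds (subst_goal (inst ts) (call N \<gamma>s G))"
    have "provable \<Sigma> D (Atom P (subst (inst ts) s))" if "closed_term \<Sigma> (subst (inst ts) s) Iota"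
    proof -
      have ts: "list_all2 (closed_term \<Sigma>) ts \<gamma>s"
      proof (cases "\<gamma>s = [Iota] \<and> s = Var 0")
        case True
        then show ?thesis using that len by (auto simp: length_Suc_conv)
      next
        case False
        then obtain c where c: "(c, arrows \<gamma>s Iota) \<in> set \<Sigma>" "s = apps (Sym c) (map Var [0..<length \<gamma>s])"
          using wf by auto
        have "subst (inst ts) s = apps (Sym c) ts"
          using c(2) len map_inst_vars[of ts _ "[]"] by (simp add: comp_def)
        then show ?thesis using closed_args[OF distinct_\<Sigma> c(1)] that by simp
      qed
      then have "provable \<Sigma> D (subst_goal (inst ts) G)"
        using len body by (simp add: holds_call sem_goalD)
      then show ?thesis using provable.intros(4)[OF assms[unfolded C] ts] by simp
    qed
    then show "holds (Atom P (subst (inst ts) s))" using wf N_notin_\<Pi> by auto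
  qed
  then show ?thesis by (simp add: C program_clause_def)
qed

lemma preserves_goal_clause:
  assumes "(\<Gamma>, G) \<in> set xs"
  shows "preserves_holds (goal_clause N (\<Gamma>, G))"
  unfolding goal_clause_def prod.case
proof (rule preserves_holdsI)
  fix ts
  assume len: "length ts = length \<Gamma>"
    and body: "holds (subst_goal (inst ts) (case G of Atom P s \<Rightarrow> Atom P s
      | Conj H K \<Rightarrow> Conj (call N \<Gamma> H) (call N \<Gamma> K)
      | Exists \<gamma> H \<Rightarrow> Atom N (App (Sym (search_sym N \<gamma>))
          (apps (Sym (body_sym N (\<Gamma>, G))) (map Var [0..<length \<Gamma>])))
      | Tru \<Rightarrow> Tru))"
  have vars: "map (inst ts \<circ> (\<lambda>i. i)) [0..<length \<Gamma>] = ts"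
    using map_inst_vars[of ts _ "[]"] len by (simp add: comp_def)
  have "provable \<Sigma> D (subst_goal (inst ts) G)" if ts: "list_all2 (closed_term \<Sigma>) ts \<Gamma>"
  proof (cases G)
    case (Atom Q t)
    then have "Q \<in> set \<Pi>" "closed_term \<Sigma> (subst (inst ts) t) Iota"
      using wf_xs[OF assms] has_type_subst[OF _ ts] by auto
    then show ?thesis using body Atom by simp
  next
    case (Conj H K)
    then have "sem (apps (Sym (goal_sym N (\<Gamma>, H))) ts)" "sem (apps (Sym (goal_sym N (\<Gamma>, K))) ts)"
      using body len by (auto simp: holds_call)
    then show ?thesis using ts Conj by (auto intro: sem_goalD provable.intros)
  next
    case (Exists \<gamma> H)
    then have "sem (apps (Sym (search_sym N \<gamma>)) [apps (Sym (body_sym N (\<Gamma>, G))) ts])"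
      using body vars by (auto simp: comp_def)
    \<comment> \<open>Inverting the search yields a witness closed over \<open>\<Sigma>\<close>, as
      the original existential rule demands.\<close>
    then obtain t where t: "closed_term \<Sigma> t \<gamma>" "sem (App (apps (Sym (body_sym N (\<Gamma>, G))) ts) t)"
      by (rule sem_searchE)
    then have "provable \<Sigma> D (subst_goal (inst (t # ts)) H)"
      using ts Exists by (intro sem_bodyD[of \<Gamma> \<gamma>]) auto
    then show ?thesis
      using provable.intros(3)[OF t(1)] Exists by (simp add: subst_goal_inst_lift)
  qed (simp add: provable.intros)
  then show "holds (Atom N (subst (inst ts) (apps (Sym (goal_sym N (\<Gamma>, G))) (map Var [0..<length \<Gamma>]))))"
    using vars N_notin_\<Pi> by (auto simp: comp_def intro: sem_goal)
qed

lemma preserves_body_clause: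
  assumes "(\<Gamma>, G) \<in> set xs"
  shows "preserves_holds (body_clause N (\<Gamma>, G))"
proof (cases G)
  case (Exists \<gamma> H)
  have "preserves_holds (Clause (\<Gamma> @ [\<gamma>])
         (Atom N (apps (Sym (goal_sym N (\<gamma> # \<Gamma>, H))) (Var (length \<Gamma>) # map Var [0..<length \<Gamma>])))
         N (apps (Sym (body_sym N (\<Gamma>, Exists \<gamma> H))) (map Var [0..<Suc (length \<Gamma>)])))"
  proof (rule preserves_holdsI)
    fix ts assume "length ts = length (\<Gamma> @ [\<gamma>])"
      and body: "holds (subst_goal (inst ts)
        (Atom N (apps (Sym (goal_sym N (\<gamma> # \<Gamma>, H))) (Var (length \<Gamma>) # map Var [0..<length \<Gamma>]))))"
    then obtain us t where ts: "ts = us @ [t]" "length us = length \<Gamma>"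
      by (cases ts rule: rev_cases) auto
    have vars: "map (\<lambda>i. inst ts i) [0..<length \<Gamma>] = us" "inst ts (length \<Gamma>) = t"
      using map_inst_vars[OF ts(2), of "[t]"] ts nth_append_length[of us t] by (simp_all add: inst_def)
    have "sem (apps (Sym (goal_sym N (\<gamma> # \<Gamma>, H))) (t # us))"
      using body vars by (simp add: comp_def)
    \<comment> \<open>Moving the witness from the first to the last place changes the symbol but not
      the provability statement behind it.\<close>
    then have "sem (apps (Sym (body_sym N (\<Gamma>, Exists \<gamma> H))) (us @ [t]))"
      by (intro sem_body sem_goalD)
    then show "holds (Atom N (subst (inst ts)
        (apps (Sym (body_sym N (\<Gamma>, Exists \<gamma> H))) (map Var [0..<Suc (length \<Gamma>)]))))"
      using vars N_notin_\<Pi> by (simp add: comp_def)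
  qed
  then show ?thesis by (simp add: body_clause_def Exists)
qed (use preserves_goal_clause[OF assms] in \<open>simp_all add: body_clause_def\<close>)

lemma preserves_sym_clause:
  assumes "(c, \<gamma>) \<in> set \<Sigma>"
  shows "preserves_holds (sym_clause N (c, \<gamma>))"
  unfolding sym_clause_def prod.case
proof (rule preserves_holdsI, clarsimp simp: length_Suc_conv N_notin_\<Pi>)
  fix w assume "sem (App w (Sym c))"
  moreover have "closed_term \<Sigma> (Sym c) \<gamma>" using assms by (rule has_type.intros)
  ultimately show "sem (App (Sym (search_sym N \<gamma>)) w)" using sem_search[of "Sym c" \<gamma> w] by simp
qed

text \<open>Two inversions find the parts of the witness: the search at \<open>\<delta>\<close>
  yields the argument \<open>t\<close>, its continuation yields the function \<open>s\<close>, and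
  \<open>App s t\<close> is the witness at \<open>\<gamma>\<close>.\<close>

lemma preserves_arg_clause: "preserves_holds (arg_clause N (\<delta>, \<gamma>))"
  unfolding arg_clause_def prod.case
proof (rule preserves_holdsI, clarsimp simp: length_Suc_conv N_notin_\<Pi>)
  fix w assume "sem (App (Sym (search_sym N \<delta>)) (App (Sym (arg_sym N (\<delta>, \<gamma>))) w))"
  then have "sem (apps (Sym (search_sym N \<delta>)) [App (Sym (arg_sym N (\<delta>, \<gamma>))) w])" by simp
  then obtain t where t: "closed_term \<Sigma> t \<delta>" "sem (apps (Sym (arg_sym N (\<delta>, \<gamma>))) [w, t])"
    by (rule sem_searchE) simp
  from t(2) obtain s where s: "closed_term \<Sigma> s (Arrow \<delta> \<gamma>)" "sem (App w (App s t))"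
    by (rule sem_argE)
  then have "closed_term \<Sigma> (App s t) \<gamma>" using t(1) by (blast intro: has_type.intros)
  then show "sem (App (Sym (search_sym N \<gamma>)) w)" using sem_search[OF _ s(2)] by simp
qed

lemma preserves_fun_clause: "preserves_holds (fun_clause N (\<delta>, \<gamma>))"
  unfolding fun_clause_def prod.case
proof (rule preserves_holdsI, clarsimp simp: length_Suc_conv N_notin_\<Pi>)
  fix w t assume "sem (App (Sym (search_sym N (Arrow \<delta> \<gamma>))) (App (App (Sym (fun_sym N (\<delta>, \<gamma>))) w) t))"
  then have "sem (apps (Sym (search_sym N (Arrow \<delta> \<gamma>))) [apps (Sym (fun_sym N (\<delta>, \<gamma>))) [w, t]])"
    by simp
  then obtain s where s: "closed_term \<Sigma> s (Arrow \<delta> \<gamma>)" "sem (apps (Sym (fun_sym N (\<delta>, \<gamma>))) [w, t, s])"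
    by (rule sem_searchE) simp
  then show "sem (App (App (Sym (arg_sym N (\<delta>, \<gamma>))) w) t)"
    using sem_arg[OF s(1) sem_funD[OF s(2)]] by simp
qed

lemma preserves_app_clause: "preserves_holds (app_clause N (\<delta>, \<gamma>))"
  unfolding app_clause_def prod.case
proof (rule preserves_holdsI, clarsimp simp: length_Suc_conv N_notin_\<Pi> numeral_2_eq_2)
  fix w t s assume "sem (App w (App s t))"
  then show "sem (App (App (App (Sym (fun_sym N (\<delta>, \<gamma>))) w) t) s)"
    using sem_fun[of w s t] by simp
qed

lemma sound: "provable \<Sigma>' D' X \<Longrightarrow> holds X"
proof (induction rule: provable.induct)
  case (4 \<gamma>s B P s ts)
  have "preserves_holds C" if "C \<in> set D'" for C
    using that unfolding reduced_defn_def
    by (auto intro: preserves_program_clause preserves_goal_clause preserves_body_clause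
        preserves_sym_clause preserves_arg_clause preserves_fun_clause preserves_app_clause)
  from this[OF 4(1)] show ?case
    using 4 list_all2_lengthD[OF 4(2)] by (simp add: preserves_holds_def)
qed auto

lemma provable_iff:
  assumes "([], G) \<in> set xs"
  shows "provable \<Sigma> D G \<longleftrightarrow> provable \<Sigma>' D' (call N [] G)"
proof
  assume "provable \<Sigma> D G"
  from complete[OF this] assms show "provable \<Sigma>' D' (call N [] G)"
    by (force simp: call_def)
next
  assume "provable \<Sigma>' D' (call N [] G)"
  then have "sem (apps (Sym (goal_sym N ([], G))) [])"
    by (auto simp: call_def dest: sound)
  then show "provable \<Sigma> D G"
    using sem_goalD[of "[]" G "[]"] by simp
qed

end

section \<open>Bounds on codes and the instance of the reduction\<close>

lemma elem_encode: "x \<in> set xs \<Longrightarrow> encode x \<le> encode xs"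
proof (induction xs)
  case (Cons y ys)
  then show ?case
    using le_prod_encode_1[of "encode y" "encode ys"] le_prod_encode_2[of "encode ys" "encode y"] by auto
qed simp

lemma list_encode_elem: "n \<in> set ns \<Longrightarrow> n \<le> list_encode ns"
  using elem_encode[of n ns] by (simp add: encode_list_def map_idI)

lemma encode_problem_components:
  "encode (funs I) \<le> encode I" "encode (preds I) \<le> encode I" "encode (defn I) \<le> encode I"
  "encode (query I) \<le> encode I"
  by (cases I; simp add: list_encode_elem del: list_encode.simps)+

text \<open>The code of a child, plus one, is a summand of the weight of all children.\<close>

lemma encode_children:
  assumes "y \<in> set (children x)"
  shows "encode (snd y) \<le> encode (snd x)"
proof -
  have "encode (snd y) \<le> weight (children x)"
    using assms member_le_sum_list[of "Suc (encode (snd y))" "map (\<lambda>x. Suc (encode (snd x))) (children x)"]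
    unfolding weight_def by fastforce
  then show ?thesis using weight_children[of x] by simp
qed

lemma reduction_reduce:
  assumes "wf_problem I"
  shows "reduction (funs I) (preds I) (defn I) (Suc (encode I)) (occurrences (roots I))"
proof
  let ?N = "Suc (encode I)" and ?xs = "occurrences (roots I)"
  show "distinct (map fst (funs I))" using assms by (simp add: wf_problem_def)
  show "c < ?N \<and> encode \<gamma> < ?N" if "(c, \<gamma>) \<in> set (funs I)" for c \<gamma>
    using elem_encode[OF that] encode_problem_components(1)[of I]
      le_prod_encode_1[of c "encode \<gamma>"] le_prod_encode_2[of "encode \<gamma>" c] by simp
  show "P < ?N" if "P \<in> set (preds I)" for P
    using elem_encode[OF that] encode_problem_components(2)[of I] by simp
  show "wf_clause (funs I) (preds I) C" if "C \<in> set (defn I)" for C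
    using assms that by (simp add: wf_problem_def)
  show "distinct ?xs" by (rule distinct_occurrences)
  show "(\<gamma>s, G) \<in> set ?xs" if "Clause \<gamma>s G P s \<in> set (defn I)" for \<gamma>s G P s
    using roots_occurrences[of "roots I"] that by (force simp: roots_def)
  show "set (children x) \<subseteq> set ?xs" if "x \<in> set ?xs" for x
    using that by (rule children_occurrences)
  \<comment> \<open>Base case for \<open>occurrences_induct\<close>, with \<open>child\<close> below
    as its step: well-formedness and the bound pass from the roots to all occurrences.\<close>
  have root: "wf_goal (funs I) (preds I) (fst x) (snd x) \<and> encode (snd x) < ?N" if "x \<in> set (roots I)" for x
  proof -
    have "encode G \<le> encode (Clause \<gamma>s G P s)" for \<gamma>s G P s
      using list_encode_elem[of "encode G"] by (simp del: list_encode.simps)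
    then have "encode G \<le> encode I" if "Clause \<gamma>s G P s \<in> set (defn I)" for \<gamma>s G P s
      using elem_encode[OF that] encode_problem_components(3)[of I] le_trans by blast
    then show ?thesis
      using that assms encode_problem_components(4)[of I]
      by (fastforce simp: roots_def wf_problem_def less_Suc_eq_le split: clause.splits)
  qed
  have child: "wf_goal (funs I) (preds I) (fst y) (snd y) \<and> encode (snd y) < ?N"
    if "wf_goal (funs I) (preds I) (fst x) (snd x) \<and> encode (snd x) < ?N" "y \<in> set (children x)" for x y
    using that encode_children[OF that(2)] by (cases "snd x") (auto simp: children_def split: prod.splits)
  have "wf_goal (funs I) (preds I) (fst x) (snd x) \<and> encode (snd x) < ?N" if "x \<in> set ?xs" for x
    using that root child by (rule occurrences_induct)
  then show "wf_goal (funs I) (preds I) \<Gamma> G" "encode G < ?N" if "(\<Gamma>, G) \<in> set ?xs" for \<Gamma> G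
    using that by fastforce+
qed

theorem theorem3p2:
  shows "\<exists>f :: problem \<Rightarrow> problem.
    computable f \<and>
    (\<forall>I. wf_problem I \<longrightarrow>
       wf_problem (f I) \<and> ex_free_problem (f I) \<and>
       (provable_problem I \<longleftrightarrow> provable_problem (f I)))"
proof (intro exI conjI allI impI)
  show "computable reduce"
    by (rule computable_if_effective) (rule effective_reduce)
next
  fix I assume wf: "wf_problem I"
  interpret reduction "funs I" "preds I" "defn I" "Suc (encode I)" "occurrences (roots I)"
    by (rule reduction_reduce[OF wf])
  have q: "([], query I) \<in> set (occurrences (roots I))"
    using roots_occurrences[of "roots I"] by (auto simp: roots_def)
  show "wf_problem (reduce I)"
    using wf distinct_\<Sigma>' wf_reduced_defn wf_call[OF q] N_notin_\<Pi> by (auto simp: wf_problem_def reduce_def)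
  show "ex_free_problem (reduce I)"
    using ex_free_reduced_defn by (auto simp: ex_free_problem_def reduce_def call_def)
  show "provable_problem I \<longleftrightarrow> provable_problem (reduce I)"
    using provable_iff[OF q] by (simp add: provable_problem_def reduce_def)
qed

end
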